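(* Let $A\in\mathbb{R}^{n\times n}$ be Hurwitz, $B\in\mathbb{R}^{n\times m}$, $C\in\mathbb{R}^{p\times n}$, and consider the linear stochastic system $dX=AX\,dt+B\,dW$, $Z=CX$ with transfer function $F(s)=C(sI_n-A)^{-1}B$. With the matrices $P,\alpha_j,\beta_j,\gamma_j,\rho_j,P_{jk}$ and the systems $G_k$ defined in the context, suppose that the pairs $(A,B)$, $(A,PC^{\mathrm T})$ and $(A,\gamma_j\rho_j)$, for all $j\in\mathbb{N}$, are controllable. Then the Hardy-Schatten norms of $F$ are related to the $\mathcal{H}_2$-norms of the systems $G_k$ by $$\|F\|_{2k}=\sqrt[k]{\|G_k\|_2}=\sqrt[2k]{\langle\beta_k,P_{kk}\rangle_{\mathrm F}},\qquad k\in\mathbb{N}.$$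
   Context: Norms: $\langle M,N\rangle_{\mathrm F}:=\mathrm{Tr}(M^*N)$ is the Frobenius inner product and $\|M\|_{\mathrm F}:=\sqrt{\langle M,M\rangle_{\mathrm F}}$. The Hardy-Schatten norms are $\|F\|_{2k}:=\Big(\frac1{2\pi}\int_{\mathbb{R}}\mathrm{Tr}\big((F(i\omega)F(i\omega)^* )^k\big)d\omega\Big)^{1/(2k)}$, and the $\mathcal{H}_2$-norm of a system $G$ is $\|G\|_2:=\Big(\frac1{2\pi}\int_{\mathbb{R}}\|G(i\omega)\|_{\mathrm F}^2\,d\omega\Big)^{1/2}$. Notation: $\mathbb{N}$ is the set of positive integers, $W$ is a standard Wiener process in $\mathbb{R}^m$, $E(s):=(sI_n-A)^{-1}$, $\mho:=BB^{\mathrm T}$, $\Omega:=C^{\mathrm T}C$, $\delta_{jk}$ is the Kronecker delta, so that $\Omega^{\delta_{j1}}$ equals $\Omega$ if $j=1$ and $I_n$ otherwise. For the Hurwitz matrix $A$, the operator $\mathcal{L}_A(V):=\int_0^\infty e^{tA}Ve^{tA^{\mathrm T}}dt$ gives the unique solution $X$ of $AX+XA^{\mathrm T}+V=0$. The matrix $P:=\mathcal{L}_A(\mho)$ is the controllability Gramian of $(A,B)$. Recursion: $\alpha_1:=\gamma_0:=P$, $\beta_0:=I_n$, $\beta_1:=P^{-1}\mho P^{-1}$, and for $j\in\mathbb{N}$, $$\gamma_j=\mathcal{L}_A(\alpha_j\Omega^{\delta_{j1}}\gamma_{j-1}),\qquad \alpha_{j+1}=\gamma_j\beta_j,\qquad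 \beta_{j+1}=\gamma_j^{-1}\alpha_j\Omega^{\delta_{j1}}\gamma_{j-1}\gamma_j^{-1}.$$ The matrices $\beta_j$ are factorised as $\beta_j=\rho_j\rho_j^{\mathrm T}$, with real matrices $\rho_j$ defined by $\rho_1:=P^{-1}B$, $\rho_2:=\gamma_1^{-1}PC^{\mathrm T}$, and $\rho_{j+1}=\gamma_j^{-1}\gamma_{j-1}\rho_{j-1}$ for $j\geqslant2$. The controllability condition in the claim is understood inductively along this recursion; it is equivalent to $\det\gamma_j\neq0$ for all $j\geqslant0$, which makes all the inverses above well defined. Systems $G_k$: $G_k(s):=\rho_k^{\mathrm T}\,\big(E(s)\alpha_k\big)\big(E(s)\alpha_{k-1}\big)\cdots\big(E(s)\alpha_1\big)\,C^{\mathrm T}$. Matrices $P_{jk}\in\mathbb{R}^{n\times n}$, $1\leqslant j\leqslant k$: $P_{11}:=\gamma_1=\mathcal{L}_A(P\Omega P)$, and for $k>1$, $$P_{jk}=\begin{cases}\mathcal{L}_A(P_{1,k-1}\alpha_k^{\mathrm T}) & \text{if } j=1,\\ \mathcal{L}_A(\alpha_jP_{j-1,k}+P_{j,k-1}\alpha_k^{\mathrm T}) & \text{if } 1<j<k,\\ \mathcal{L}_A(\alpha_kP_{k-1,k}+P_{k-1,k}^{\mathrm T}\alpha_k^{\mathrm T}) & \text{if } j=k.\end{cases}$$ *)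

theory Defs
  imports "HOL-Analysis.Analysis"
begin

section \<open>Matrix preliminaries\<close>

text \<open>An \<open>n \<times> m\<close> matrix has type \<^typ>\<open>'a^'m^'n\<close>. On these types the overloaded \<open>*\<close>, \<open>^\<close>
  and \<open>1\<close> are componentwise, so products, powers and the identity are written with
  \<open>**\<close>, \<open>matpow\<close> and \<open>mat 1\<close>.\<close>

primrec matpow :: "'a::semiring_1^'n^'n \<Rightarrow> nat \<Rightarrow> 'a^'n^'n" where
  "matpow M 0 = mat 1"
| "matpow M (Suc k) = M ** matpow M k"

definition mexp :: "real^'n^'n \<Rightarrow> real^'n^'n" where
  "mexp M = (\<Sum>k. (1 / fact k) *\<^sub>R matpow M k)"

definition cmat :: "real^'m^'n \<Rightarrow> complex^'m^'n" where
  "cmat M = map_matrix complex_of_real M"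

definition ctranspose :: "complex^'m^'n \<Rightarrow> complex^'n^'m" where
  "ctranspose M = transpose (map_matrix cnj M)"

definition frob_inner :: "complex^'m^'n \<Rightarrow> complex^'m^'n \<Rightarrow> complex" where
  "frob_inner M N = trace (ctranspose M ** N)"

definition frob_norm :: "complex^'m^'n \<Rightarrow> real" where
  "frob_norm M = sqrt (Re (frob_inner M M))"

definition frob_inner_real :: "real^'m^'n \<Rightarrow> real^'m^'n \<Rightarrow> real" where
  "frob_inner_real M N = trace (transpose M ** N)"

lemma frob_inner_cmat: "frob_inner (cmat M) (cmat N) = complex_of_real (frob_inner_real M N)"
  by (simp add: frob_inner_def frob_inner_real_def cmat_def ctranspose_def trace_def
      matrix_matrix_mult_def transpose_def map_matrix_def)

lemma frob_inner_real_eq_inner: "frob_inner_real M N = M \<bullet> N"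
  unfolding frob_inner_real_def trace_def matrix_matrix_mult_def transpose_def inner_vec_def
  by (simp, rule sum.swap)

lemma frob_norm_eq_norm: "frob_norm M = norm M"
proof -
  have "Re (frob_inner M M) = (\<Sum>j\<in>UNIV. \<Sum>i\<in>UNIV. (norm (M $ i $ j))\<^sup>2)"
    unfolding frob_inner_def trace_def matrix_matrix_mult_def ctranspose_def transpose_def map_matrix_def
    by (simp add: cmod_power2) (simp add: power2_eq_square)
  also have "\<dots> = (\<Sum>i\<in>UNIV. \<Sum>j\<in>UNIV. (norm (M $ i $ j))\<^sup>2)"
    by (rule sum.swap)
  finally show ?thesis
    by (simp add: frob_norm_def norm_vec_def L2_set_def sum_nonneg)
qed

section \<open>Linear systems\<close>

definition hurwitz :: "real^'n^'n \<Rightarrow> bool" where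
  "hurwitz A \<longleftrightarrow> (\<forall>l v. v \<noteq> 0 \<and> cmat A *v v = l *s v \<longrightarrow> Re l < 0)"

text \<open>The Kalman matrix \<open>[B, AB, \<dots>, A\<^sup>n\<^sup>-\<^sup>1B]\<close> has full rank \<open>n\<close>.\<close>

definition controllable :: "real^'n^'n \<Rightarrow> real^'m^'n \<Rightarrow> bool" where
  "controllable A B \<longleftrightarrow> dim (\<Union>k<CARD('n). columns (matpow A k ** B)) = CARD('n)"

definition lyap :: "real^'n^'n \<Rightarrow> real^'n^'n \<Rightarrow> real^'n^'n" where
  "lyap A V = (LINT t:{0..}|lborel. mexp (t *\<^sub>R A) ** V ** mexp (t *\<^sub>R transpose A))"

definition resolvent :: "real^'n^'n \<Rightarrow> complex \<Rightarrow> complex^'n^'n" where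
  "resolvent A s = matrix_inv (mat s - cmat A)"

definition transfer_fun :: "real^'n^'n \<Rightarrow> real^'m^'n \<Rightarrow> real^'n^'p \<Rightarrow> complex \<Rightarrow> complex^'m^'p" where
  "transfer_fun A B C s = cmat C ** resolvent A s ** cmat B"

text \<open>\<open>hs_norm k F\<close> is the norm with index \<open>2k\<close>. The trace is that of a positive
  semidefinite Hermitian matrix, hence real.\<close>

definition hs_norm :: "nat \<Rightarrow> (complex \<Rightarrow> complex^'m^'p) \<Rightarrow> real" where
  "hs_norm k F = root (2 * k) (1 / (2 * pi) *
     (LINT \<omega>|lborel. Re (trace (matpow (F (\<i> * complex_of_real \<omega>) **
        ctranspose (F (\<i> * complex_of_real \<omega>))) k))))"

definition h2_norm :: "(complex \<Rightarrow> complex^'m^'p) \<Rightarrow> real" where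
  "h2_norm G = sqrt (1 / (2 * pi) *
     (LINT \<omega>|lborel. (frob_norm (G (\<i> * complex_of_real \<omega>)))\<^sup>2))"

section \<open>The recursion\<close>

definition ctr_gram :: "real^'n^'n \<Rightarrow> real^'m^'n \<Rightarrow> real^'n^'n" where
  "ctr_gram A B = lyap A (B ** transpose B)"

definition Omega_delta :: "real^'n^'p \<Rightarrow> nat \<Rightarrow> real^'n^'n" where
  "Omega_delta C j = (if j = 1 then transpose C ** C else mat 1)"

text \<open>\<open>alpha\<close> is indexed from 1; its value at 0 is never used.\<close>

fun alpha :: "real^'n^'n \<Rightarrow> real^'m^'n \<Rightarrow> real^'n^'p \<Rightarrow> nat \<Rightarrow> real^'n^'n"
  and beta :: "real^'n^'n \<Rightarrow> real^'m^'n \<Rightarrow> real^'n^'p \<Rightarrow> nat \<Rightarrow> real^'n^'n"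
  and gamma :: "real^'n^'n \<Rightarrow> real^'m^'n \<Rightarrow> real^'n^'p \<Rightarrow> nat \<Rightarrow> real^'n^'n" where
  "alpha A B C 0 = undefined"
| "alpha A B C (Suc 0) = ctr_gram A B"
| "alpha A B C (Suc (Suc j)) = gamma A B C (Suc j) ** beta A B C (Suc j)"
| "beta A B C 0 = mat 1"
| "beta A B C (Suc 0) =
     matrix_inv (ctr_gram A B) ** (B ** transpose B) ** matrix_inv (ctr_gram A B)"
| "beta A B C (Suc (Suc j)) =
     matrix_inv (gamma A B C (Suc j)) ** alpha A B C (Suc j) ** Omega_delta C (Suc j)
       ** gamma A B C j ** matrix_inv (gamma A B C (Suc j))"
| "gamma A B C 0 = ctr_gram A B"
| "gamma A B C (Suc j) = lyap A (alpha A B C (Suc j) ** Omega_delta C (Suc j) ** gamma A B C j)"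

text \<open>The number of columns of \<open>\<rho>\<^sub>j\<close> alternates: \<open>\<rho>\<^sub>j\<close> is \<open>n \<times> m\<close> for odd \<open>j\<close> (an \<open>Inl\<close>
  value) and \<open>n \<times> p\<close> for even \<open>j\<close> (an \<open>Inr\<close> value). The index starts at 1.\<close>

fun rho :: "real^'n^'n \<Rightarrow> real^'m^'n \<Rightarrow> real^'n^'p \<Rightarrow> nat \<Rightarrow> real^'m^'n + real^'p^'n" where
  "rho A B C 0 = undefined"
| "rho A B C (Suc 0) = Inl (matrix_inv (ctr_gram A B) ** B)"
| "rho A B C (Suc (Suc 0)) =
     Inr (matrix_inv (gamma A B C 1) ** ctr_gram A B ** transpose C)"
| "rho A B C (Suc (Suc (Suc j))) =
     (let M = matrix_inv (gamma A B C (Suc (Suc j))) ** gamma A B C (Suc j)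
      in map_sum (\<lambda>R. M ** R) (\<lambda>R. M ** R) (rho A B C (Suc j)))"

primrec cascade :: "real^'n^'n \<Rightarrow> real^'m^'n \<Rightarrow> real^'n^'p \<Rightarrow> nat \<Rightarrow> complex \<Rightarrow> complex^'n^'n" where
  "cascade A B C 0 s = mat 1"
| "cascade A B C (Suc k) s = (resolvent A s ** cmat (alpha A B C (Suc k))) ** cascade A B C k s"

text \<open>\<open>G\<^sub>k(s)\<close> has the shape \<open>m \<times> p\<close> for odd \<open>k\<close> and \<open>p \<times> p\<close> for even \<open>k\<close>.\<close>

definition sysG :: "real^'n^'n \<Rightarrow> real^'m^'n \<Rightarrow> real^'n^'p \<Rightarrow> nat \<Rightarrow>
    (complex \<Rightarrow> complex^'p^'m) + (complex \<Rightarrow> complex^'p^'p)" where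
  "sysG A B C k = map_sum
     (\<lambda>R s. cmat (transpose R) ** cascade A B C k s ** cmat (transpose C))
     (\<lambda>R s. cmat (transpose R) ** cascade A B C k s ** cmat (transpose C))
     (rho A B C k)"

text \<open>\<open>Pmat A B C j k\<close> is \<open>P\<^sub>j\<^sub>k\<close>, meaningful for \<open>1 \<le> j \<le> k\<close>.\<close>

fun Pmat :: "real^'n^'n \<Rightarrow> real^'m^'n \<Rightarrow> real^'n^'p \<Rightarrow> nat \<Rightarrow> nat \<Rightarrow> real^'n^'n" where
  "Pmat A B C j k =
    (if j < 1 \<or> k < j then undefined
     else if k = 1 then gamma A B C 1
     else if j = 1 then lyap A (Pmat A B C 1 (k - 1) ** transpose (alpha A B C k))
     else if j < k then
       lyap A (alpha A B C j ** Pmat A B C (j - 1) k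
               + Pmat A B C j (k - 1) ** transpose (alpha A B C k))
     else
       lyap A (alpha A B C k ** Pmat A B C (k - 1) k
               + transpose (Pmat A B C (k - 1) k) ** transpose (alpha A B C k)))"

declare Pmat.simps [simp del]

end

theory Submission
  imports Defs "HOL-Complex_Analysis.Cauchy_Integral_Theorem" "HOL-Probability.Sinc_Integral"
    "HOL-Computational_Algebra.Fundamental_Theorem_Algebra"
begin

text \<open>
  Write \<open>s = i\<omega>\<close>, \<open>E = (s - A)\<^sup>-\<^sup>1\<close> and let \<open>E*\<close> be its adjoint. If \<open>X\<close> is symmetric, invertible and
  \<open>AX + XA\<^sup>T + V = 0\<close>, then \<open>V = (s - A)X + X(s - A)*\<close>, hence \<open>EVE* = XE* + EX = X(E*X\<^sup>-\<^sup>1VX\<^sup>-\<^sup>1E)X\<close>.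
  Applied along the recursion this says that
  \<open>R\<^sub>k := \<gamma>\<^sub>k E*\<beta>\<^sub>k\<^sub>+\<^sub>1E \<gamma>\<^sub>k\<close> equals \<open>E \<gamma>\<^sub>k\<^sub>-\<^sub>1\<beta>\<^sub>k\<^sub>-\<^sub>1\<gamma>\<^sub>k\<^sub>-\<^sub>1 E*\<close> for \<open>k \<ge> 2\<close> and \<open>E P\<Omega>P E*\<close> for \<open>k = 1\<close>.
  Consequently \<open>T\<^sub>k := (E\<alpha>\<^sub>k)\<dots>(E\<alpha>\<^sub>1) \<Omega> ((E\<alpha>\<^sub>k)\<dots>(E\<alpha>\<^sub>1))*\<close> is \<open>(R\<^sub>k\<beta>\<^sub>k)\<^sup>k\<^sup>-\<^sup>1R\<^sub>k\<close>, and
  cyclicity of the trace gives \<open>tr(\<beta>\<^sub>kT\<^sub>k) = tr((R\<^sub>k\<beta>\<^sub>k)\<^sup>k) = \<dots> = tr((R\<^sub>1\<beta>\<^sub>1)\<^sup>k) = tr((FF*)\<^sup>k)\<close>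
  pointwise on the imaginary axis, although \<open>G\<^sub>k*G\<^sub>k\<close> and \<open>(FF*)\<^sup>k\<close> themselves differ in general. The integral of
  \<open>T\<^sub>k\<close> is \<open>2\<pi>P\<^sub>k\<^sub>k\<close>: the integrals of \<open>H\<^sub>j\<Omega>H\<^sub>k*\<close>, \<open>H\<^sub>j = (E\<alpha>\<^sub>j)\<dots>(E\<alpha>\<^sub>1)\<close>, solve the Lyapunov
  equations that define the \<open>P\<^sub>j\<^sub>k\<close>, because \<open>H\<^sub>k\<close> with \<open>k \<ge> 2\<close> is \<open>O(s\<^sup>-\<^sup>2)\<close> in the right half plane and
  so has integral zero. All \<open>\<gamma>\<^sub>j\<close> are invertible since the kernel of a symmetric solution of
  \<open>AX + XA\<^sup>T + RR\<^sup>T = 0\<close> is \<open>A\<^sup>T\<close>-invariant and annihilated by \<open>R\<^sup>T\<close>.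
\<close>

section \<open>Matrix algebra\<close>

text \<open>The class constraint covers both \<open>real\<close> and \<open>complex\<close> entries;
  the two interpretations below then supply distributivity, continuity, derivatives and norm bounds
  for matrix products.\<close>

lemma bounded_bilinear_matrix_mult:
  "bounded_bilinear ((**) :: 'a::{euclidean_space,real_normed_algebra_1}^'n^'m \<Rightarrow> 'a^'k^'n \<Rightarrow> 'a^'k^'m)"
  unfolding bilinear_conv_bounded_bilinear[symmetric]
  by (auto simp: bilinear_def linear_iff matrix_matrix_mult_def vec_eq_iff
      distrib_left distrib_right sum.distrib scaleR_sum_right)

interpretation matrix_mult_real: bounded_bilinear "(**) :: real^'n^'m \<Rightarrow> real^'k^'n \<Rightarrow> real^'k^'m"
  by (rule bounded_bilinear_matrix_mult)

interpretation matrix_mult_complex: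
  bounded_bilinear "(**) :: complex^'n^'m \<Rightarrow> complex^'k^'n \<Rightarrow> complex^'k^'m"
  by (rule bounded_bilinear_matrix_mult)

lemma matrix_inv_right_left:
  fixes M :: "'a::field^'n^'n"
  assumes "invertible M"
  shows "M ** matrix_inv M = mat 1" "matrix_inv M ** M = mat 1"
  using someI_ex[OF assms[unfolded invertible_def]] by (auto simp: matrix_inv_def)

lemma invertible_if_ker_trivial:
  fixes M :: "'a::field^'n^'n"
  assumes "\<And>v. M *v v = 0 \<Longrightarrow> v = 0"
  shows "invertible M"
  using assms invertible_left_inverse matrix_left_invertible_ker by blast

text \<open>A one-sided inverse of a square matrix over a field is two-sided.\<close>

lemma matrix_inv_eqI:
  fixes M :: "'a::field^'n^'n"
  assumes "M ** N = mat 1"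
  shows "matrix_inv M = N"
proof -
  have "invertible M"
    using assms matrix_left_right_inverse[of N M] matrix_left_right_inverse[of M N]
    unfolding invertible_def by blast
  then have "matrix_inv M ** (M ** N) = N"
    by (simp add: matrix_mul_assoc matrix_inv_right_left)
  then show ?thesis using assms by simp
qed

lemma transpose_matrix_inv:
  fixes M :: "'a::field^'n^'n"
  assumes "invertible M"
  shows "transpose (matrix_inv M) = matrix_inv (transpose M)"
  by (rule matrix_inv_eqI[symmetric])
    (simp add: matrix_transpose_mul[symmetric] matrix_inv_right_left assms)

lemma transpose_add: "transpose (X + Y) = transpose X + transpose (Y :: 'a::plus^'n^'m)"
  by (simp add: transpose_def vec_eq_iff)

section \<open>Complexification and adjoints\<close>

lemma cmat_mult: "cmat (X ** Y) = cmat X ** cmat Y"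
  by (simp add: cmat_def matrix_matrix_mult_def vec_eq_iff)

lemma cmat_add: "cmat (X + Y) = cmat X + cmat Y"
  by (simp add: cmat_def vec_eq_iff)

lemma cmat_scaleR: "cmat (r *\<^sub>R X) = r *\<^sub>R cmat X"
  by (simp add: cmat_def vec_eq_iff) (simp add: scaleR_conv_of_real)

lemma cmat_zero [simp]: "cmat 0 = 0"
  by (simp add: cmat_def vec_eq_iff)

lemma cmat_mat [simp]: "cmat (mat r) = mat (complex_of_real r)"
  by (simp add: cmat_def mat_def vec_eq_iff)

lemma bounded_linear_cmat: "bounded_linear (cmat :: real^'n^'m \<Rightarrow> _)"
  by (unfold linear_conv_bounded_linear[symmetric], rule linearI) (simp_all add: cmat_add cmat_scaleR)

lemma ctranspose_cmat [simp]: "ctranspose (cmat X) = cmat (transpose X)"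
  by (simp add: ctranspose_def cmat_def transpose_def vec_eq_iff)

lemma ctranspose_mult: "ctranspose (X ** Y) = ctranspose Y ** ctranspose X"
  by (simp add: ctranspose_def transpose_def matrix_matrix_mult_def vec_eq_iff mult.commute)

lemma ctranspose_add: "ctranspose (X + Y) = ctranspose X + ctranspose Y"
  by (simp add: ctranspose_def transpose_def vec_eq_iff)

lemma ctranspose_diff: "ctranspose (X - Y) = ctranspose X - ctranspose Y"
  by (simp add: ctranspose_def transpose_def vec_eq_iff)

lemma ctranspose_mat [simp]: "ctranspose (mat c) = mat (cnj c)"
  by (simp add: ctranspose_def transpose_def mat_def vec_eq_iff)

lemma ctranspose_ctranspose [simp]: "ctranspose (ctranspose X) = X"
  by (simp add: ctranspose_def transpose_def vec_eq_iff)

lemma ctranspose_scaleR: "ctranspose (r *\<^sub>R X) = r *\<^sub>R ctranspose X"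
  by (simp add: ctranspose_def transpose_def vec_eq_iff)

lemma bounded_linear_ctranspose: "bounded_linear (ctranspose :: complex^'n^'m \<Rightarrow> _)"
  by (unfold linear_conv_bounded_linear[symmetric], rule linearI) (simp_all add: ctranspose_add ctranspose_scaleR)

lemma bounded_linear_transpose: "bounded_linear (transpose :: real^'n^'m \<Rightarrow> _)"
  by (unfold linear_conv_bounded_linear[symmetric], rule linearI) (simp_all add: transpose_add transpose_scalar)

lemma bounded_linear_trace: "bounded_linear (trace :: complex^'n^'n \<Rightarrow> _)"
  by (unfold linear_conv_bounded_linear[symmetric], rule linearI)
    (simp_all add: trace_def sum.distrib scaleR_sum_right)

lemma norm_ctranspose: "norm (ctranspose X) = norm (X :: complex^'n^'m)"
proof -
  have "(\<Sum>i\<in>UNIV. \<Sum>j\<in>UNIV. (cmod (cnj (X $ j $ i)))\<^sup>2) = (\<Sum>i\<in>UNIV. \<Sum>j\<in>UNIV. (cmod (X $ i $ j))\<^sup>2)"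
    by (simp, rule sum.swap)
  then show ?thesis
    by (simp add: norm_vec_def L2_set_def sum_nonneg ctranspose_def transpose_def)
qed

section \<open>Matrix powers and cyclicity of the trace\<close>

lemma matpow_commute: "matpow X k ** X = X ** matpow (X :: 'a::semiring_1^'n^'n) k"
  by (induction k) (simp_all add: matrix_mul_assoc[symmetric])

text \<open>Regrouping of the alternating word \<open>U W U W ... U W\<close>; this carries powers
  from one index of the recursion to the next.\<close>

lemma matpow_shift:
  fixes U :: "'a::semiring_1^'n^'m" and W :: "'a^'m^'n"
  shows "U ** matpow (W ** U) k ** W = matpow (U ** W) (Suc k)"
proof (induction k)
  case (Suc k)
  have "U ** matpow (W ** U) (Suc k) ** W = (U ** W) ** (U ** matpow (W ** U) k ** W)"
    by (simp add: matrix_mul_assoc)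
  then show ?case using Suc by simp
qed simp

lemma trace_matpow_commute:
  fixes U :: "'a::comm_semiring_1^'n^'m" and W :: "'a^'m^'n"
  assumes "1 \<le> k"
  shows "trace (matpow (U ** W) k) = trace (matpow (W ** U) k)"
proof -
  obtain j where k: "k = Suc j" using assms by (cases k) auto
  have "trace (matpow (U ** W) k) = trace (U ** (matpow (W ** U) j ** W))"
    by (simp only: k matpow_shift[symmetric] matrix_mul_assoc)
  also have "\<dots> = trace ((matpow (W ** U) j ** W) ** U)" by (rule trace_mul_sym)
  also have "\<dots> = trace (matpow (W ** U) k)"
    by (simp only: k matrix_mul_assoc[symmetric] matpow_commute matpow.simps)
  finally show ?thesis .
qed

lemma matpow_transpose: "matpow (transpose X) k = transpose (matpow (X :: 'a::comm_semiring_1^'n^'n) k)"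
  by (induction k) (simp_all add: matrix_transpose_mul[symmetric] matpow_commute)

lemma matpow_scaleR: "matpow (t *\<^sub>R X) k = t ^ k *\<^sub>R matpow (X :: real^'n^'n) k"
  by (induction k) (simp_all add: matrix_mult_real.scaleR_left matrix_mult_real.scaleR_right)

text \<open>Here \<open>E\<close>, \<open>E'\<close>, \<open>Y\<close> are the inverses of
  \<open>M\<close>, \<open>N\<close>, \<open>X\<close>. Both forms reduce to
  \<open>X ** E' + E ** X\<close>: for the second, \<open>Y ** V ** Y = Y ** M + N ** Y\<close>,
  which becomes \<open>E' ** Y + Y ** E\<close> between \<open>E'\<close> and
  \<open>E\<close>.\<close>

lemma spectral_factor_swap:
  fixes E E' M N X Y V :: "complex^'n^'n"
  assumes "E ** M = mat 1" "M ** E = mat 1" "E' ** N = mat 1" "N ** E' = mat 1"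
    and "X ** Y = mat 1" "Y ** X = mat 1" and V: "V = M ** X + X ** N"
  shows "E ** V ** E' = X ** E' + E ** X"
    and "E ** V ** E' = X ** (E' ** (Y ** V ** Y) ** E) ** X"
proof -
  note inv = assms(1-6)
  have c: "E ** (M ** Z) = Z" "M ** (E ** Z) = Z" "E' ** (N ** Z) = Z" "N ** (E' ** Z) = Z"
    "X ** (Y ** Z) = Z" "Y ** (X ** Z) = Z" for Z :: "complex^'n^'n"
    by (simp_all add: matrix_mul_assoc inv)
  note simps = matrix_mult_complex.add_left matrix_mult_complex.add_right
    matrix_mul_assoc[symmetric] inv c
  show 1: "E ** V ** E' = X ** E' + E ** X"
    by (simp add: V simps)
  show "E ** V ** E' = X ** (E' ** (Y ** V ** Y) ** E) ** X"
    unfolding 1 by (simp add: V simps)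
qed

text \<open>For \<open>U = E ** g j ** b j\<close> and \<open>W = g j ** E' ** b (Suc j)\<close>,
  consecutive products \<open>R j ** b j\<close> and \<open>R (Suc j) ** b (Suc j)\<close> are
  \<open>W ** U\<close> and \<open>U ** W\<close>. Exchanging the factors preserves traces of
  powers, and \<open>matpow_shift\<close> absorbs the outer factors that \<open>T\<close> gains at
  each index.\<close>

lemma cascade_power:
  fixes E E' :: "complex^'n^'n" and b g R T :: "nat \<Rightarrow> complex^'n^'n"
  assumes R: "\<And>k. 1 \<le> k \<Longrightarrow> R k = g k ** (E' ** b (Suc k) ** E) ** g k"
    and R_Suc: "\<And>k. 1 \<le> k \<Longrightarrow> R (Suc k) = E ** (g k ** b k ** g k) ** E'"
    and T_1: "T 1 = R 1"
    and T_Suc: "\<And>k. 1 \<le> k \<Longrightarrow> T (Suc k) = (E ** (g k ** b k)) ** T k ** ((b k ** g k) ** E')"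
  shows "T (Suc j) = matpow (R (Suc j) ** b (Suc j)) j ** R (Suc j)"
    and "1 \<le> k \<Longrightarrow> trace (matpow (R (Suc j) ** b (Suc j)) k) = trace (matpow (R 1 ** b 1) k)"
proof -
  have UW: "R (Suc j) ** b (Suc j) = (g (Suc j) ** E' ** b (Suc (Suc j))) ** (E ** g (Suc j) ** b (Suc j))"
    "R (Suc (Suc j)) ** b (Suc (Suc j)) =
      (E ** g (Suc j) ** b (Suc j)) ** (g (Suc j) ** E' ** b (Suc (Suc j)))" for j
    by (simp add: R matrix_mul_assoc, simp add: R_Suc matrix_mul_assoc)
  show "T (Suc j) = matpow (R (Suc j) ** b (Suc j)) j ** R (Suc j)"
  proof (induction j)
    case 0
    then show ?case using T_1 by simp
  next
    case (Suc j)
    define U where "U = E ** g (Suc j) ** b (Suc j)"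
    define W where "W = g (Suc j) ** E' ** b (Suc (Suc j))"
    \<comment> \<open>The two descriptions of \<open>R\<close> meet here: the first, at
      \<open>Suc j\<close>, exposes an \<open>E\<close> that completes
      \<open>E ** (g ** b ** g) ** E'\<close>, which is the second description at the next
      index.\<close>
    have RW: "R (Suc j) ** ((b (Suc j) ** g (Suc j)) ** E') = W ** R (Suc (Suc j))"
      unfolding R_Suc[of "Suc j", simplified] R[of "Suc j", simplified] W_def
      by (simp add: matrix_mul_assoc)
    have "T (Suc (Suc j)) = U ** (matpow (W ** U) j ** R (Suc j)) ** ((b (Suc j) ** g (Suc j)) ** E')"
      unfolding T_Suc[of "Suc j", simplified] Suc UW U_def W_def by (simp add: matrix_mul_assoc)
    also have "\<dots> = U ** matpow (W ** U) j ** (R (Suc j) ** ((b (Suc j) ** g (Suc j)) ** E'))"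
      by (simp only: matrix_mul_assoc)
    also have "\<dots> = (U ** matpow (W ** U) j ** W) ** R (Suc (Suc j))"
      unfolding RW by (simp only: matrix_mul_assoc)
    also have "\<dots> = matpow (U ** W) (Suc j) ** R (Suc (Suc j))"
      by (simp only: matpow_shift)
    finally show ?case by (simp only: UW(2) U_def W_def)
  qed
  show "trace (matpow (R (Suc j) ** b (Suc j)) k) = trace (matpow (R 1 ** b 1) k)" if "1 \<le> k"
  proof (induction j)
    case (Suc j)
    have "trace (matpow (R (Suc (Suc j)) ** b (Suc (Suc j))) k) = trace (matpow (R (Suc j) ** b (Suc j)) k)"
      unfolding UW(2)[of j] UW(1)[of j] by (rule trace_matpow_commute[OF that])
    then show ?case using Suc by simp
  qed simp
qed

section \<open>Controllability and kernels of Lyapunov solutions\<close>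

text \<open>The assumption makes \<open>v\<close> orthogonal to all columns of the Kalman matrix.
  These span the space, so \<open>v\<close> is orthogonal to itself.\<close>

lemma controllable_imp_trivial:
  fixes A :: "real^'n^'n" and R :: "real^'m^'n"
  assumes "controllable A R" and "\<And>k. transpose R *v (matpow (transpose A) k *v v) = 0"
  shows "v = 0"
proof -
  let ?S = "\<Union>k<CARD('n). columns (matpow A k ** R)"
  have "orthogonal v x" if "x \<in> ?S" for x
  proof -
    obtain k j where x: "x = column j (matpow A k ** R)"
      using \<open>x \<in> ?S\<close> unfolding columns_def by blast
    have "v \<bullet> x = (transpose (matpow A k ** R) *v v) $ j"
      by (simp add: x column_def matrix_vector_mult_def transpose_def inner_vec_def mult.commute
          del: transpose_matrix_vector)
    also have "transpose (matpow A k ** R) *v v = transpose R *v (matpow (transpose A) k *v v)"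
      by (simp add: matrix_transpose_mul matpow_transpose matrix_vector_mul_assoc
          del: transpose_matrix_vector)
    finally show ?thesis by (simp add: assms(2) orthogonal_def del: transpose_matrix_vector)
  qed
  moreover have "span ?S = UNIV"
    using assms(1) dim_eq_full[of ?S] by (simp add: controllable_def)
  ultimately have "orthogonal v v"
    using orthogonal_to_span[of v ?S v] by simp
  then show ?thesis by (simp add: orthogonal_def)
qed

text \<open>Pairing the equation with a kernel vector \<open>v\<close> removes both terms containing
  \<open>X\<close>, by symmetry, and leaves the squared length of \<open>transpose R *v v\<close>,
  which therefore vanishes. The equation applied to \<open>v\<close> then puts
  \<open>transpose A *v v\<close> into the kernel as well, so the argument can be iterated.\<close>

lemma invertible_if_lyapunov_controllable:
  fixes A X :: "real^'n^'n" and R :: "real^'m^'n"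
  assumes lyap: "A ** X + X ** transpose A + R ** transpose R = 0"
    and sym: "transpose X = X" and ctr: "controllable A R"
  shows "invertible X"
proof (rule invertible_if_ker_trivial)
  fix v assume v: "X *v v = 0"
  have step: "transpose R *v v = 0 \<and> X *v (transpose A *v v) = 0" if v: "X *v v = 0" for v
  proof -
    have eq: "A *v (X *v v) + X *v (transpose A *v v) + R *v (transpose R *v v) = 0"
      using arg_cong[OF lyap, of "\<lambda>M. M *v v"]
      by (simp add: matrix_vector_mult_add_rdistrib matrix_vector_mul_assoc del: transpose_matrix_vector)
    have "v \<bullet> (X *v w) = (X *v v) \<bullet> w" for w
      by (metis dot_lmul_matrix sym transpose_matrix_vector)
    then have "v \<bullet> (R *v (transpose R *v v)) = 0"
      using arg_cong[OF eq, of "\<lambda>w. v \<bullet> w"] v by (simp add: inner_add_right)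
    then have "transpose R *v v = 0"
      by (simp add: dot_lmul_matrix[symmetric])
    then show ?thesis using eq v by simp
  qed
  have "X *v (matpow (transpose A) k *v v) = 0" for k
  proof (induction k)
    case (Suc k)
    then show ?case using step[OF Suc] by (simp add: matrix_vector_mul_assoc del: transpose_matrix_vector)
  qed (use v in simp)
  then show "v = 0"
    using step by (intro controllable_imp_trivial[OF ctr]) blast
qed

section \<open>The matrix exponential\<close>

text \<open>The norm is submultiplicative for the matrix product only up to a constant
  \<open>K\<close>, so the majorant is the series of \<open>exp (norm M * K)\<close>.\<close>

lemma summable_mexp:
  fixes M :: "real^'n^'n"
  shows "summable (\<lambda>k. (1 / fact k) *\<^sub>R matpow M k)"
proof -
  obtain K where K: "0 < K" "\<And>(X :: real^'n^'n) (Y :: real^'n^'n). norm (X ** Y) \<le> norm X * norm Y * K"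
    using matrix_mult_real.pos_bounded by blast
  have bound: "norm (matpow M k) \<le> norm (mat 1 :: real^'n^'n) * (norm M * K) ^ k" for k
  proof (induction k)
    case (Suc k)
    have "norm (matpow M (Suc k)) \<le> norm M * norm (matpow M k) * K"
      using K(2)[of M "matpow M k"] by simp
    also have "\<dots> \<le> norm M * (norm (mat 1 :: real^'n^'n) * (norm M * K) ^ k) * K"
      using Suc K(1) by (intro mult_right_mono mult_left_mono) auto
    finally show ?case by (simp add: mult_ac)
  qed simp
  show ?thesis
  proof (rule summable_comparison_test)
    show "summable (\<lambda>k. norm (mat 1 :: real^'n^'n) * (inverse (fact k) * (norm M * K) ^ k))"
      by (intro summable_mult summable_exp)
    show "\<exists>N. \<forall>k\<ge>N. norm ((1 / fact k) *\<^sub>R matpow M k)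
        \<le> norm (mat 1 :: real^'n^'n) * (inverse (fact k) * (norm M * K) ^ k)"
      using mult_left_mono[OF bound, of "inverse (fact k)" for k]
      by (auto simp: divide_inverse mult_ac)
  qed
qed

lemma mexp_zero [simp]:
  "mexp (0 :: real^'n^'n) = mat 1"
proof -
  have "(1 / fact k) *\<^sub>R matpow 0 k = (if k = 0 then mat 1 else (0 :: real^'n^'n))" for k
    by (cases k) (simp_all add: matrix_mult_real.zero_left)
  then have "mexp (0 :: real^'n^'n) = (\<Sum>k. if k = 0 then mat 1 else 0)"
    by (simp add: mexp_def)
  also have "\<dots> = mat 1"
    using suminf_finite[of "{0::nat}" "\<lambda>k. if k = 0 then mat 1 else (0 :: real^'n^'n)"] by simp
  finally show ?thesis .
qed

lemma mexp_transpose: "mexp (transpose M) = transpose (mexp M)"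
  unfolding mexp_def bounded_linear.suminf[OF bounded_linear_transpose summable_mexp]
  by (simp add: matpow_transpose transpose_scalar)

lemma mexp_scaleR_commute: "A ** mexp (t *\<^sub>R A) = mexp (t *\<^sub>R A) ** A"
  unfolding mexp_def
    bounded_linear.suminf[OF matrix_mult_real.bounded_linear_right summable_mexp]
    bounded_linear.suminf[OF matrix_mult_real.bounded_linear_left summable_mexp]
  by (simp add: matpow_scaleR matrix_mult_real.scaleR_left matrix_mult_real.scaleR_right matpow_commute)

lemma has_vector_derivative_matrix:
  fixes f :: "real \<Rightarrow> real^'m^'n"
  assumes "\<And>i j. ((\<lambda>t. f t $ i $ j) has_vector_derivative f' $ i $ j) (at t)"
  shows "(f has_vector_derivative f') (at t)"
  unfolding has_vector_derivative_def
  by (subst has_derivative_componentwise_within)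
    (use assms in \<open>auto simp: Basis_vec_def inner_axis has_vector_derivative_def\<close>)

text \<open>Each entry is a real power series in \<open>t\<close> that converges everywhere, so it
  may be differentiated term by term.\<close>

lemma has_vector_derivative_mexp:
  fixes A :: "real^'n^'n"
  shows "((\<lambda>t. mexp (t *\<^sub>R A)) has_vector_derivative A ** mexp (t *\<^sub>R A)) (at t)"
proof (rule has_vector_derivative_matrix)
  fix i j
  define c where "c n = matpow A n $ i $ j / fact n" for n
  have nth: "bounded_linear (\<lambda>M :: real^'n^'n. M $ i $ j)"
    by (intro bounded_linear_compose[OF bounded_linear_vec_nth] bounded_linear_vec_nth)
  have c: "((1 / fact n) *\<^sub>R matpow (t *\<^sub>R A) n) $ i $ j = c n * t ^ n" for n t
    by (simp add: c_def matpow_scaleR)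
  have summable: "summable (\<lambda>n. c n * t ^ n)" for t
    using bounded_linear.summable[OF nth summable_mexp[of "t *\<^sub>R A"]] unfolding c .
  have mexp: "mexp (t *\<^sub>R A) $ i $ j = (\<Sum>n. c n * t ^ n)" for t
    unfolding mexp_def bounded_linear.suminf[OF nth summable_mexp] c ..
  have "(A ** mexp (t *\<^sub>R A)) $ i $ j = (\<Sum>n. diffs c n * t ^ n)"
  proof -
    have s: "summable (\<lambda>n. A ** ((1 / fact n) *\<^sub>R matpow (t *\<^sub>R A) n))"
      by (rule bounded_linear.summable[OF matrix_mult_real.bounded_linear_right summable_mexp])
    have "(A ** ((1 / fact n) *\<^sub>R matpow (t *\<^sub>R A) n)) $ i $ j = diffs c n * t ^ n" for n
      by (simp add: matpow_scaleR matrix_mult_real.scaleR_right diffs_def c_def del: of_nat_Suc)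
    then show ?thesis
      unfolding mexp_def bounded_linear.suminf[OF matrix_mult_real.bounded_linear_right summable_mexp]
        bounded_linear.suminf[OF nth s] by simp
  qed
  then show "((\<lambda>t. mexp (t *\<^sub>R A) $ i $ j) has_vector_derivative (A ** mexp (t *\<^sub>R A)) $ i $ j) (at t)"
    unfolding mexp has_real_derivative_iff_has_vector_derivative[symmetric]
    using termdiffs_strong_converges_everywhere[OF summable] by simp
qed

section \<open>Exponential decay\<close>

text \<open>The rate is existentially quantified because it shrinks along the way: a sum keeps the
  smaller rate, and solving a differential equation may lose part of it.\<close>

definition exp_decay :: "(real \<Rightarrow> 'a::real_normed_vector) \<Rightarrow> bool" where
  "exp_decay f \<longleftrightarrow> (\<exists>K d. 0 < d \<and> (\<forall>t\<ge>0. norm (f t) \<le> K * exp (- d * t)))"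

lemma exp_decayE:
  assumes "exp_decay f"
  obtains K d where "0 < d" "0 \<le> K" "\<And>t. 0 \<le> t \<Longrightarrow> norm (f t) \<le> K * exp (- d * t)"
proof -
  obtain K d where d: "0 < d" and K: "\<And>t. 0 \<le> t \<Longrightarrow> norm (f t) \<le> K * exp (- d * t)"
    using assms by (auto simp: exp_decay_def)
  have "0 \<le> K" using order_trans[OF norm_ge_zero K[of 0]] by simp
  then show ?thesis using that d K by blast
qed

lemma exp_decay_mono:
  assumes "exp_decay g" "\<And>t. norm (f t) \<le> norm (g t)"
  shows "exp_decay f"
  using assms(1)
proof (rule exp_decayE)
  fix K d assume "0 < d" "\<And>t. 0 \<le> t \<Longrightarrow> norm (g t) \<le> K * exp (- d * t)"
  then show ?thesis
    unfolding exp_decay_def using order_trans[OF assms(2)] by blast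
qed

lemma exp_decay_bounded_linear:
  assumes "exp_decay f" "bounded_linear h"
  shows "exp_decay (\<lambda>t. h (f t))"
proof -
  obtain K d where d: "0 < d" and K: "\<And>t. 0 \<le> t \<Longrightarrow> norm (f t) \<le> K * exp (- d * t)"
    using assms(1) by (rule exp_decayE) blast
  obtain L where L: "0 < L" "\<And>x. norm (h x) \<le> norm x * L"
    using bounded_linear.pos_bounded[OF assms(2)] by blast
  have "norm (h (f t)) \<le> (K * L) * exp (- d * t)" if "0 \<le> t" for t
    using order_trans[OF L(2) mult_right_mono[OF K[OF that]]] L(1) by (simp add: mult_ac)
  then show ?thesis using d unfolding exp_decay_def by blast
qed

lemma exp_decay_sum:
  assumes "exp_decay f" "exp_decay g"
  shows "exp_decay (\<lambda>t. f t + g t)"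
proof -
  obtain K d where d: "0 < d" "0 \<le> K" and K: "\<And>t. 0 \<le> t \<Longrightarrow> norm (f t) \<le> K * exp (- d * t)"
    using assms(1) by (rule exp_decayE) blast
  obtain L e where e: "0 < e" "0 \<le> L" and L: "\<And>t. 0 \<le> t \<Longrightarrow> norm (g t) \<le> L * exp (- e * t)"
    using assms(2) by (rule exp_decayE) blast
  have "norm (f t + g t) \<le> (K + L) * exp (- min d e * t)" if "0 \<le> t" for t
  proof -
    have "norm (f t + g t) \<le> K * exp (- d * t) + L * exp (- e * t)"
      by (rule norm_triangle_le[OF add_mono[OF K[OF that] L[OF that]]])
    also have "\<dots> \<le> K * exp (- min d e * t) + L * exp (- min d e * t)"
      using that d e by (intro add_mono mult_left_mono) (auto simp: mult_right_mono)
    finally show ?thesis by (simp add: distrib_right)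
  qed
  then show ?thesis
    using d e unfolding exp_decay_def by (intro exI[of _ "K + L"] exI[of _ "min d e"]) auto
qed

lemma exp_decay_matrix:
  fixes f :: "real \<Rightarrow> complex^'m^'n"
  assumes "\<And>i j. exp_decay (\<lambda>t. f t $ i $ j)"
  shows "exp_decay f"
proof -
  have add: "exp_decay (\<lambda>t. \<Sum>x\<in>S. g x t)"
    if "finite S" "\<And>x. x \<in> S \<Longrightarrow> exp_decay (g x)" for S :: "'x set" and g :: "'x \<Rightarrow> real \<Rightarrow> real"
    using that
  proof (induction S)
    case empty
    have "exp_decay (\<lambda>t. 0::real)" unfolding exp_decay_def by (intro exI[of _ 0] exI[of _ 1]) simp
    then show ?case by simp
  qed (simp add: exp_decay_sum)
  have "exp_decay (\<lambda>t. norm (f t $ i $ j))" for i j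
    using assms[of i j] by (simp add: exp_decay_def)
  then have "exp_decay (\<lambda>t. \<Sum>i\<in>UNIV. \<Sum>j\<in>UNIV. norm (f t $ i $ j))"
    by (intro add) auto
  moreover have "norm (f t) \<le> norm (\<Sum>i\<in>UNIV. \<Sum>j\<in>UNIV. norm (f t $ i $ j))" for t
  proof -
    have "norm (f t) \<le> (\<Sum>i\<in>UNIV. norm (f t $ i))"
      by (simp add: norm_vec_def L2_set_le_sum)
    also have "\<dots> \<le> (\<Sum>i\<in>UNIV. \<Sum>j\<in>UNIV. norm (f t $ i $ j))"
      by (intro sum_mono) (metis L2_set_le_sum norm_ge_zero norm_vec_def)
    finally show ?thesis by simp
  qed
  ultimately show ?thesis by (rule exp_decay_mono)
qed

text \<open>Integrating factor: \<open>w = exp (- z * t) * y\<close> has a derivative bounded by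
  \<open>K * exp (a * t)\<close>, so the mean value inequality bounds its increment by that of
  \<open>K / a * exp (a * t)\<close>. Multiplying back by \<open>exp (Re z * t)\<close> gives the
  rate \<open>d\<close>, as \<open>Re z + a = - d\<close>.\<close>

lemma exp_decay_ode:
  fixes y :: "real \<Rightarrow> complex"
  assumes y: "\<And>t. (y has_vector_derivative z * y t + g t) (at t)"
    and z: "Re z < 0" and g: "exp_decay g"
  shows "exp_decay y"
proof -
  obtain K e where e: "0 < e" "0 \<le> K" and K: "\<And>t. 0 \<le> t \<Longrightarrow> norm (g t) \<le> K * exp (- e * t)"
    using g by (rule exp_decayE) blast
  \<comment> \<open>The bound \<open>e\<close> lets \<open>g\<close> be absorbed into
    \<open>exp (a * s)\<close>; halving \<open>- Re z\<close> keeps \<open>a\<close> positive even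
    if both rates coincide.\<close>
  define d where "d = min e (- Re z / 2)"
  define a where "a = - Re z - d"
  have d: "0 < d" "d \<le> e" and a: "0 < a" using e z by (auto simp: d_def a_def min_def)
  define w where "w t = exp (- z * of_real t) * y t" for t
  have "((\<lambda>t. exp (- z * complex_of_real t)) has_vector_derivative - z * exp (- z * of_real t)) (at t)" for t
    by (rule has_vector_derivative_real_field) (auto intro!: derivative_eq_intros)
  then have w: "(w has_vector_derivative exp (- z * of_real t) * g t) (at t)" for t
    unfolding w_def
    by (rule has_vector_derivative_eq_rhs[OF has_vector_derivative_mult[OF _ y]]) (auto simp: algebra_simps)
  have phi: "((\<lambda>t. K / a * exp (a * t)) has_vector_derivative K * exp (a * t)) (at t)" for t
    unfolding has_real_derivative_iff_has_vector_derivative[symmetric]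
    using a by (auto intro!: derivative_eq_intros)
  have y_bound: "norm (y t) \<le> (norm (y 0) + K / a) * exp (- d * t)" if t: "0 \<le> t" for t
  proof -
    have g_bound: "norm (exp (- z * of_real s) * g s) \<le> K * exp (a * s)" if "0 \<le> s" for s
    proof -
      have "norm (exp (- z * of_real s) * g s) \<le> exp (- Re z * s) * (K * exp (- e * s))"
        using K[OF that] by (simp add: norm_mult)
      also have "\<dots> = K * exp ((- Re z - e) * s)"
        by (simp add: exp_add[symmetric] algebra_simps)
      also have "\<dots> \<le> K * exp (a * s)"
        using d that e by (intro mult_left_mono) (auto simp: a_def mult_right_mono)
      finally show ?thesis .
    qed
    have "norm (w t - w 0) \<le> K / a * exp (a * t) - K / a * exp (a * 0)"
    proof (cases "t = 0")
      case False
      show ?thesis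
      proof (rule differentiable_bound_general[where f' = "\<lambda>s. exp (- z * of_real s) * g s" and \<phi>' = "\<lambda>s. K * exp (a * s)"])
        show "0 < t" using False t by simp
        show "continuous_on {0..t} w"
          using w by (intro continuous_at_imp_continuous_on) (blast intro: has_vector_derivative_continuous)
        show "continuous_on {0..t} (\<lambda>s. K / a * exp (a * s))" by (intro continuous_intros)
      qed (use w phi g_bound in auto)
    qed simp
    also have "\<dots> \<le> K / a * exp (a * t)" using e a by simp
    finally have "norm (w t) \<le> norm (w 0) + K / a * exp (a * t)"
      by (smt (verit, best) norm_triangle_sub)
    then have "exp (Re z * t) * norm (w t) \<le> exp (Re z * t) * (norm (y 0) + K / a * exp (a * t))"
      by (simp add: w_def)
    also have "exp (Re z * t) * norm (w t) = norm (y t)"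
      by (simp add: w_def norm_mult exp_add[symmetric] mult.assoc[symmetric])
    also have "exp (Re z * t) * (norm (y 0) + K / a * exp (a * t)) =
        norm (y 0) * exp (Re z * t) + K / a * exp (- d * t)"
      by (simp add: a_def distrib_left exp_add[symmetric] algebra_simps)
    also have "\<dots> \<le> norm (y 0) * exp (- d * t) + K / a * exp (- d * t)"
    proof (intro add_mono mult_left_mono order_refl)
      have "Re z * t \<le> - d * t" using t a by (intro mult_right_mono) (auto simp: a_def)
      then show "exp (Re z * t) \<le> exp (- d * t)" by simp
    qed (use e a in auto)
    finally show ?thesis by (simp add: distrib_right)
  qed
  then show ?thesis using d(1) unfolding exp_decay_def by blast
qed

section \<open>Polynomials in a matrix\<close>

text \<open>Horner evaluation with the matrix product; \<open>poly\<close> would use the overloaded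
  \<open>*\<close>, which is entrywise on this type.\<close>

definition poly_matrix :: "complex^'n^'n \<Rightarrow> complex poly \<Rightarrow> complex^'n^'n" where
  "poly_matrix M p = fold_coeffs (\<lambda>a S. mat a + M ** S) p 0"

lemma poly_matrix_0 [simp]: "poly_matrix M 0 = 0"
  by (simp add: poly_matrix_def)

lemma poly_matrix_pCons [simp]: "poly_matrix M (pCons a p) = mat a + M ** poly_matrix M p"
proof (cases "p = 0 \<and> a = 0")
  case True
  then show ?thesis by (simp add: matrix_mult_complex.zero_right)
next
  case False
  then have "fold_coeffs (\<lambda>a S. mat a + M ** S) (pCons a p)
      = (\<lambda>S. mat a + M ** S) \<circ> fold_coeffs (\<lambda>a S. mat a + M ** S) p"
    using fold_coeffs_pCons_coeff_not_0_eq fold_coeffs_pCons_not_0_0_eq by blast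
  then show ?thesis by (simp only: poly_matrix_def o_apply)
qed

lemma mat_add: "mat (a + b) = mat a + (mat b :: 'a::monoid_add^'n^'n)"
  by (simp add: mat_def vec_eq_iff)

lemma mat_mult_nth: "(mat a ** M) $ i $ j = a * (M :: 'a::semiring_1^'m^'n) $ i $ j"
proof -
  have "(mat a ** M) $ i $ j = (\<Sum>k\<in>UNIV. if k = i then a * M $ k $ j else 0)"
    unfolding mat_def matrix_matrix_mult_def vec_lambda_beta by (rule sum.cong) auto
  then show ?thesis by simp
qed

lemma mult_mat_nth: "(M ** mat a) $ i $ j = (M :: 'a::semiring_1^'n^'m) $ i $ j * a"
proof -
  have "(M ** mat a) $ i $ j = (\<Sum>k\<in>UNIV. if k = j then M $ i $ k * a else 0)"
    unfolding mat_def matrix_matrix_mult_def vec_lambda_beta by (rule sum.cong) auto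
  then show ?thesis by simp
qed

lemma mat_mult_mat: "mat (a * b) = mat a ** (mat b :: 'a::semiring_1^'n^'n)"
  by (simp add: vec_eq_iff mat_mult_nth) (simp add: mat_def)

lemma mat_mult_commute: "mat a ** M = M ** mat (a :: 'a::comm_semiring_1)"
  by (simp add: vec_eq_iff mat_mult_nth mult_mat_nth mult.commute)

lemma mat_mult_right_commute: "M ** (mat a ** N) = mat (a :: complex) ** (M ** N)"
  by (metis mat_mult_commute matrix_mul_assoc)

lemma poly_matrix_add: "poly_matrix M (p + q) = poly_matrix M p + poly_matrix M q"
  by (induction p q rule: poly_induct2) (simp_all add: mat_add matrix_mult_complex.add_right)

lemma poly_matrix_smult: "poly_matrix M (smult c p) = mat c ** poly_matrix M p"
  by (induction p)
    (simp_all add: mat_mult_mat matrix_mult_complex.add_right matrix_mult_complex.zero_right mat_mult_right_commute)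

lemma poly_matrix_linear_factor:
  fixes M :: "complex^'n^'n"
  shows "poly_matrix M ([:- z, 1:] * p) = (M - mat z) ** poly_matrix M p"
proof -
  have "mat (- z) + mat z = (0 :: complex^'n^'n)"
    by (simp add: mat_add[symmetric])
  then have "mat (- z) = - (mat z :: complex^'n^'n)"
    by (simp add: add_eq_0_iff2)
  moreover have "poly_matrix M ([:- z, 1:] * p) = poly_matrix M (smult (- z) p + pCons 0 p)"
    by simp
  moreover have "\<dots> = mat (- z) ** poly_matrix M p + M ** poly_matrix M p"
    by (simp only: poly_matrix_add poly_matrix_smult poly_matrix_pCons) simp
  ultimately show ?thesis
    by (simp add: matrix_mult_complex.diff_left matrix_mult_complex.minus_left)
qed

lemma poly_matrix_monom: "poly_matrix M (monom c k) = mat c ** matpow M k"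
  by (induction k) (simp_all add: monom_0 monom_Suc matrix_mult_complex.zero_right mat_mult_right_commute)

lemma poly_matrix_sum: "poly_matrix M (\<Sum>i\<in>S. f i) = (\<Sum>i\<in>S. poly_matrix M (f i))"
  by (induction S rule: infinite_finite_induct) (simp_all add: poly_matrix_add)

lemma matpow_cmat: "matpow (cmat A) k = cmat (matpow A k)"
  by (induction k) (simp_all add: cmat_mult)

lemma cmat_sum: "cmat (\<Sum>i\<in>S. f i) = (\<Sum>i\<in>S. cmat (f i))"
  by (induction S rule: infinite_finite_induct) (simp_all add: cmat_add)

lemma mat_of_real_mult: "mat (complex_of_real c) ** M = c *\<^sub>R M"
  by (simp add: vec_eq_iff mat_mult_nth) (simp add: scaleR_conv_of_real)

text \<open>Dimension count: the powers up to exponent \<open>N\<close>, the dimension of the matrix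
  space, are \<open>N + 1\<close> elements of that space and hence satisfy a nontrivial linear
  relation.\<close>

lemma ex_annihilating_poly:
  fixes A :: "real^'n^'n"
  obtains p where "p \<noteq> 0" "poly_matrix (cmat A) p = 0"
proof -
  let ?N = "DIM(real^'n^'n)"
  let ?S = "matpow A ` {..?N}"
  have "\<exists>c. (\<exists>i\<le>?N. c i \<noteq> 0) \<and> (\<Sum>i\<le>?N. c i *\<^sub>R matpow A i) = 0"
  \<comment> \<open>Linear dependence is a property of the set of powers. If two powers coincide,
    the set is smaller than the family, and their difference is the relation.\<close>
  proof (cases "inj_on (matpow A) {..?N}")
    case True
    then have "card ?S = Suc ?N" by (simp add: card_image)
    then have "dependent ?S"
      using independent_bound[of ?S] by auto
    then obtain u where u: "\<exists>v\<in>?S. u v \<noteq> 0" "(\<Sum>v\<in>?S. u v *\<^sub>R v) = 0"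
      using dependent_finite[of ?S] by auto
    moreover have "(\<Sum>i\<le>?N. u (matpow A i) *\<^sub>R matpow A i) = (\<Sum>v\<in>?S. u v *\<^sub>R v)"
      by (simp only: sum.reindex[OF True] o_def)
    ultimately show ?thesis
      by (intro exI[of _ "\<lambda>i. u (matpow A i)"]) auto
  next
    case False
    then obtain i j where ij: "i \<le> ?N" "j \<le> ?N" "matpow A i = matpow A j" "i \<noteq> j"
      by (auto simp: inj_on_def)
    let ?c = "\<lambda>k. of_bool (k = i) - of_bool (k = j) :: real"
    have "(\<Sum>k\<le>?N. ?c k *\<^sub>R matpow A k)
        = (\<Sum>k\<le>?N. if k = i then matpow A k else 0) - (\<Sum>k\<le>?N. if k = j then matpow A k else 0)"
      unfolding sum_subtractf[symmetric] by (intro sum.cong) auto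
    also have "\<dots> = 0" using ij by simp
    finally show ?thesis
      using ij by (intro exI[of _ ?c]) auto
  qed
  then obtain c i where c: "i \<le> ?N" "c i \<noteq> 0" "(\<Sum>i\<le>?N. c i *\<^sub>R matpow A i) = 0" by blast
  let ?p = "\<Sum>i\<le>?N. monom (complex_of_real (c i)) i"
  have "coeff ?p i = complex_of_real (c i)"
    using c(1) by (simp add: coeff_sum)
  then have "?p \<noteq> 0" using c(2) by auto
  moreover have "poly_matrix (cmat A) ?p = cmat (\<Sum>i\<le>?N. c i *\<^sub>R matpow A i)"
    by (simp add: poly_matrix_sum poly_matrix_monom mat_of_real_mult matpow_cmat cmat_sum cmat_scaleR)
  ultimately show ?thesis
    using that c(3) by simp
qed

lemma poly_matrix_prod_list:
  "poly_matrix M (prod_list (map (\<lambda>z. [:- z, 1:]) zs)) = foldr (\<lambda>z Q. (M - mat z) ** Q) zs (mat 1)"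
  by (induction zs)
    (simp_all add: one_pCons poly_matrix_linear_factor matrix_mult_complex.zero_right del: mult_pCons_left)

text \<open>Over the complex numbers the annihilating polynomial is its leading coefficient times
  linear factors; that coefficient is nonzero and can be cancelled.\<close>

lemma ex_annihilating_factors:
  fixes A :: "real^'n^'n"
  obtains zs where "foldr (\<lambda>z Q. (cmat A - mat z) ** Q) zs (mat 1) = 0"
proof -
  obtain p where p: "p \<noteq> 0" "poly_matrix (cmat A) p = 0" by (rule ex_annihilating_poly)
  obtain Z where Z: "p = smult (lead_coeff p) (\<Prod>x\<in>#Z. [:- x, 1:])"
    using alg_closed_imp_factorization[OF p(1)] by blast
  obtain zs where zs: "mset zs = Z" using ex_mset by blast
  have "(\<Prod>x\<in>#Z. [:- x, 1:]) = prod_list (map (\<lambda>z. [:- z, 1:]) zs)"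
    by (simp add: zs[symmetric] prod_mset_prod_list[symmetric])
  then have *: "mat (lead_coeff p) ** foldr (\<lambda>z Q. (cmat A - mat z) ** Q) zs (mat 1) = 0"
    using p(2) Z poly_matrix_smult poly_matrix_prod_list by metis
  then have "foldr (\<lambda>z Q. (cmat A - mat z) ** Q) zs (mat 1) = 0"
    using p(1) by (simp add: vec_eq_iff mat_mult_nth)
  then show ?thesis by (rule that)
qed

lemma invertible_if_not_eigenvalue:
  fixes M :: "complex^'n^'n"
  assumes "\<And>v. M *v v = z *s v \<Longrightarrow> v = 0"
  shows "invertible (mat z - M)"
proof (rule invertible_if_ker_trivial)
  fix v :: "complex^'n" assume "(mat z - M) *v v = 0"
  then have "M *v v = mat z *v v" by (simp add: matrix_vector_mult_diff_rdistrib)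
  also have "mat z *v v = z *s v"
  proof -
    have "(\<Sum>k\<in>UNIV. (if i = k then z else 0) * v $ k) = (\<Sum>k\<in>UNIV. if k = i then z * v $ k else 0)" for i
      by (rule sum.cong) auto
    then show ?thesis by (simp add: vec_eq_iff matrix_vector_mult_def mat_def)
  qed
  finally show "v = 0" by (rule assms)
qed

text \<open>The factor \<open>cmat A\<close> is placed on the right, next to the constant matrix by
  which the exponential gets multiplied.\<close>

lemma has_vector_derivative_cmat_mexp:
  "((\<lambda>t. cmat (mexp (t *\<^sub>R A))) has_vector_derivative cmat (mexp (t *\<^sub>R A)) ** cmat A) (at t)"
  using bounded_linear.has_vector_derivative[OF bounded_linear_cmat has_vector_derivative_mexp]
  by (simp add: mexp_scaleR_commute cmat_mult)

lemma exp_decay_factor: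
  fixes A :: "real^'n^'n" and Q :: "complex^'n^'n"
  assumes "hurwitz A"
    and decay: "exp_decay (\<lambda>t. cmat (mexp (t *\<^sub>R A)) ** ((cmat A - mat z) ** Q))"
  shows "exp_decay (\<lambda>t. cmat (mexp (t *\<^sub>R A)) ** Q)"
proof (cases "Re z < 0")
  case True
  define y where "y t = cmat (mexp (t *\<^sub>R A)) ** Q" for t
  define g where "g t = cmat (mexp (t *\<^sub>R A)) ** ((cmat A - mat z) ** Q)" for t
  \<comment> \<open>Writing \<open>A = z + (A - z)\<close> in front of \<open>Q\<close> turns each
    entry of \<open>y\<close> into a solution of a scalar equation with decaying
    inhomogeneity.\<close>
  have y: "(y has_vector_derivative mat z ** y t + g t) (at t)" for t
  proof -
    have "(y has_vector_derivative (cmat (mexp (t *\<^sub>R A)) ** cmat A) ** Q) (at t)"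
      unfolding y_def
      by (rule bounded_linear.has_vector_derivative[OF matrix_mult_complex.bounded_linear_left has_vector_derivative_cmat_mexp])
    also have "(cmat (mexp (t *\<^sub>R A)) ** cmat A) ** Q = mat z ** y t + g t"
      by (simp add: y_def g_def matrix_mult_complex.diff_left matrix_mult_complex.diff_right
          mat_mult_right_commute matrix_mul_assoc[symmetric])
    finally show ?thesis .
  qed
  have nth: "bounded_linear (\<lambda>M :: complex^'n^'n. M $ i $ j)" for i j
    by (intro bounded_linear_compose[OF bounded_linear_vec_nth] bounded_linear_vec_nth)
  have "exp_decay (\<lambda>t. y t $ i $ j)" for i j
  proof (rule exp_decay_ode[where z = z and g = "\<lambda>t. g t $ i $ j"])
    show "((\<lambda>t. y t $ i $ j) has_vector_derivative z * y t $ i $ j + g t $ i $ j) (at t)" for t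
      using bounded_linear.has_vector_derivative[OF nth y, of i j t] by (simp add: mat_mult_nth)
    show "exp_decay (\<lambda>t. g t $ i $ j)"
      using exp_decay_bounded_linear[OF decay nth] by (simp add: g_def)
  qed fact
  then show ?thesis unfolding y_def by (rule exp_decay_matrix)
next
  case False
  let ?M = "cmat A - mat z"
  \<comment> \<open>All eigenvalues of a Hurwitz matrix have negative real part, so \<open>z\<close>
    is none of them. As \<open>A - z\<close> commutes with the exponential, its inverse can be
    applied from the left.\<close>
  have inv: "invertible (mat z - cmat A)"
    using assms(1) False by (intro invertible_if_not_eigenvalue) (auto simp: hurwitz_def)
  have "(- matrix_inv (mat z - cmat A)) ** ?M = mat 1"
    using matrix_inv_right_left(2)[OF inv]
    by (simp add: matrix_mult_complex.minus_left matrix_mult_complex.diff_right)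
  then have c: "(- matrix_inv (mat z - cmat A)) ** (?M ** X) = X" for X :: "complex^'n^'n"
    by (simp add: matrix_mul_assoc)
  have comm: "cmat (mexp (t *\<^sub>R A)) ** (?M ** Q) = ?M ** (cmat (mexp (t *\<^sub>R A)) ** Q)" for t
    by (simp add: matrix_mult_complex.diff_left matrix_mult_complex.diff_right mat_mult_right_commute)
      (simp add: matrix_mul_assoc cmat_mult[symmetric] mexp_scaleR_commute)
  show ?thesis
    using exp_decay_bounded_linear[OF decay
        matrix_mult_complex.bounded_linear_right[of "- matrix_inv (mat z - cmat A)"]]
    by (simp only: comm c)
qed

lemma norm_cmat: "norm (cmat X) = norm X"
  by (simp add: norm_vec_def cmat_def)

text \<open>
  An annihilating polynomial of \<open>A\<close> splits into linear factors. Multiplying the zero matrix \<open>e\<^sup>t\<^sup>Ap(A)\<close> back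
  up, one removes a factor \<open>A - z\<close> at a time by solving \<open>y' = zy + g\<close> with \<open>g\<close> decaying if \<open>Re z < 0\<close>,
  and by inverting \<open>A - z\<close> otherwise.
\<close>

lemma exp_decay_mexp:
  assumes "hurwitz A"
  shows "exp_decay (\<lambda>t. mexp (t *\<^sub>R A))"
proof -
  obtain zs where zs: "foldr (\<lambda>z Q. (cmat A - mat z) ** Q) zs (mat 1) = 0"
    by (rule ex_annihilating_factors)
  have "exp_decay (\<lambda>t. cmat (mexp (t *\<^sub>R A)) ** foldr (\<lambda>z Q. (cmat A - mat z) ** Q) zs (mat 1))
      \<Longrightarrow> exp_decay (\<lambda>t. cmat (mexp (t *\<^sub>R A)) ** mat 1)"
    by (induction zs) (use exp_decay_factor[OF assms] in simp_all)
  moreover have "exp_decay (\<lambda>t. cmat (mexp (t *\<^sub>R A)) ** 0)"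
    unfolding exp_decay_def by (intro exI[of _ 0] exI[of _ 1]) (simp add: matrix_mult_complex.zero_right)
  ultimately show ?thesis
    using zs by (simp add: exp_decay_def norm_cmat)
qed

section \<open>The Lyapunov integral\<close>

lemma exp_decay_bilinear:
  assumes "bounded_bilinear h" "exp_decay f" "exp_decay g"
  shows "exp_decay (\<lambda>t. h (f t) (g t))"
proof -
  obtain K d where d: "0 < d" "0 \<le> K" and K: "\<And>t. 0 \<le> t \<Longrightarrow> norm (f t) \<le> K * exp (- d * t)"
    using assms(2) by (rule exp_decayE) blast
  obtain L e where e: "0 < e" "0 \<le> L" and L: "\<And>t. 0 \<le> t \<Longrightarrow> norm (g t) \<le> L * exp (- e * t)"
    using assms(3) by (rule exp_decayE) blast
  obtain H where H: "0 < H" "\<And>x y. norm (h x y) \<le> norm x * norm y * H"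
    using bounded_bilinear.pos_bounded[OF assms(1)] by blast
  have "norm (h (f t) (g t)) \<le> (K * L * H) * exp (- (d + e) * t)" if "0 \<le> t" for t
  proof -
    have "norm (f t) * norm (g t) \<le> (K * exp (- d * t)) * (L * exp (- e * t))"
      using K[OF that] L[OF that] d by (intro mult_mono) auto
    then have "norm (h (f t) (g t)) \<le> (K * exp (- d * t)) * (L * exp (- e * t)) * H"
      using H(1) by (intro order_trans[OF H(2)] mult_right_mono) auto
    also have "\<dots> = (K * L * H) * (exp (- d * t) * exp (- e * t))"
      by (simp only: mult_ac)
    also have "exp (- d * t) * exp (- e * t) = exp (- (d + e) * t)"
      by (simp add: exp_add[symmetric] algebra_simps)
    finally show ?thesis .
  qed
  then show ?thesis
    using d e unfolding exp_decay_def by (intro exI[of _ "K * L * H"] exI[of _ "d + e"]) auto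
qed

lemma exp_decay_tendsto_zero:
  assumes "exp_decay f"
  shows "(f \<longlongrightarrow> 0) at_top"
  using assms
proof (rule exp_decayE)
  fix K d assume d: "0 < d" and K: "\<And>t. 0 \<le> t \<Longrightarrow> norm (f t) \<le> K * exp (- d * t)"
  have "((\<lambda>t. K * exp (- d * t)) \<longlongrightarrow> 0) at_top"
    using d by real_asymp
  then show ?thesis
    by (rule Lim_null_comparison[rotated]) (use K in \<open>auto simp: eventually_at_top_linorder\<close>)
qed

lemma set_integrable_exp_decay:
  fixes f :: "real \<Rightarrow> 'a::euclidean_space"
  assumes cont: "continuous_on {0..} f" and "exp_decay f"
  shows "set_integrable lborel {0..} f"
  using assms(2)
proof (rule exp_decayE)
  fix K d assume d: "0 < d" and K0: "0 \<le> K"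
    and K: "\<And>t. 0 \<le> t \<Longrightarrow> norm (f t) \<le> K * exp (- d * t)"
  have "(\<integral>\<^sup>+x. ennreal (K * exp (- d * x)) * indicator {0..} x \<partial>lborel) = 0 - (- K / d * exp (- d * 0))"
  proof (rule nn_integral_FTC_atLeast)
    show "((\<lambda>x. - K / d * exp (- d * x)) \<longlongrightarrow> 0) at_top" using d by real_asymp
  qed (use d K0 in \<open>auto intro!: derivative_eq_intros\<close>)
  moreover have "(\<integral>\<^sup>+x. ennreal (norm (indicator {0..} x *\<^sub>R (K * exp (- d * x)))) \<partial>lborel)
      = (\<integral>\<^sup>+x. ennreal (K * exp (- d * x)) * indicator {0..} x \<partial>lborel)"
    by (intro nn_integral_cong) (use K0 in \<open>auto simp: indicator_def\<close>)
  ultimately have "set_integrable lborel {0..} (\<lambda>x. K * exp (- d * x))"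
    unfolding set_integrable_def by (intro integrableI_bounded) auto
  then show ?thesis
  proof (rule set_integrable_bound)
    show "set_borel_measurable lborel {0..} f"
      unfolding set_borel_measurable_def
      using borel_measurable_continuous_on_indicator[OF _ cont] by simp
  qed (use K K0 in auto)
qed

text \<open>The fundamental theorem on \<open>{0..b}\<close>, with \<open>b\<close> tending to
  infinity: decay of \<open>f'\<close> gives integrability, decay of \<open>f\<close> removes the
  upper boundary term.\<close>

lemma integral_derivative_exp_decay:
  fixes f :: "real \<Rightarrow> 'a::euclidean_space"
  assumes f: "\<And>t. (f has_vector_derivative f' t) (at t)" "exp_decay f"
    and f': "continuous_on UNIV f'" "exp_decay f'"
  shows "(LINT t:{0..}|lborel. f' t) = - f 0"
proof -
  have "((\<lambda>b. LINT t:{0..b}|lborel. f' t) \<longlongrightarrow> (LINT t:{0..}|lborel. f' t)) at_top"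
    using continuous_on_subset[OF f'(1)] f'(2)
    by (intro tendsto_set_lebesgue_integral_at_top set_integrable_exp_decay) auto
  moreover have "eventually (\<lambda>b. (LINT t:{0..b}|lborel. f' t) = f b - f 0) at_top"
    using eventually_ge_at_top[of 0]
  proof eventually_elim
    case (elim b)
    then show ?case
      unfolding set_lebesgue_integral_def
      by (intro integral_FTC_atLeastAtMost has_vector_derivative_at_within[OF f(1)]
          continuous_on_subset[OF f'(1)]) auto
  qed
  ultimately have "((\<lambda>b. f b - f 0) \<longlongrightarrow> (LINT t:{0..}|lborel. f' t)) at_top"
    by (rule Lim_transform_eventually)
  moreover have "((\<lambda>b. f b - f 0) \<longlongrightarrow> 0 - f 0) at_top"
    by (intro tendsto_diff exp_decay_tendsto_zero f(2) tendsto_const)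
  ultimately show ?thesis
    using tendsto_unique[OF trivial_limit_at_top_linorder] by fastforce
qed

lemma set_integral_bounded_linear:
  fixes f :: "'x \<Rightarrow> 'a::{banach,second_countable_topology}"
    and T :: "'a \<Rightarrow> 'b::{banach,second_countable_topology}"
  assumes "bounded_linear T" "set_integrable M S f"
  shows "(LINT x:S|M. T (f x)) = T (LINT x:S|M. f x)"
  using integral_bounded_linear[OF assms(1) assms(2)[unfolded set_integrable_def]]
  by (simp add: set_lebesgue_integral_def linear_cmul[OF bounded_linear.linear[OF assms(1)]])

text \<open>The solution of \<open>X' = AX + XA^T\<close> with initial value \<open>V\<close>, and
  the integrand of \<open>lyap A V\<close>.\<close>

definition lyap_flow :: "real^'n^'n \<Rightarrow> real^'n^'n \<Rightarrow> real \<Rightarrow> real^'n^'n" where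
  "lyap_flow A V t = mexp (t *\<^sub>R A) ** V ** mexp (t *\<^sub>R transpose A)"

lemma has_vector_derivative_lyap_flow:
  "(lyap_flow A V has_vector_derivative A ** lyap_flow A V t + lyap_flow A V t ** transpose A) (at t)"
  unfolding lyap_flow_def
  by (rule has_vector_derivative_eq_rhs[OF matrix_mult_real.has_vector_derivative[OF
        bounded_linear.has_vector_derivative[OF matrix_mult_real.bounded_linear_left has_vector_derivative_mexp]
        has_vector_derivative_mexp]])
    (simp add: mexp_scaleR_commute[of "transpose A"] matrix_mul_assoc add.commute)

lemma continuous_lyap_flow: "continuous_on S (lyap_flow A V)"
  by (meson continuous_at_imp_continuous_on has_vector_derivative_continuous has_vector_derivative_lyap_flow)

lemma exp_decay_lyap_flow:
  assumes "hurwitz A"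
  shows "exp_decay (lyap_flow A V)"
proof -
  have "exp_decay (\<lambda>t. mexp (t *\<^sub>R transpose A))"
    using exp_decay_bounded_linear[OF exp_decay_mexp[OF assms] bounded_linear_transpose]
    by (simp add: mexp_transpose[symmetric] transpose_scalar)
  then show ?thesis
    unfolding lyap_flow_def
    by (rule exp_decay_bilinear[OF bounded_bilinear_matrix_mult
          exp_decay_bounded_linear[OF exp_decay_mexp[OF assms] matrix_mult_real.bounded_linear_left]])
qed

lemma set_integrable_lyap_flow:
  "hurwitz A \<Longrightarrow> set_integrable lborel {0..} (lyap_flow A V)"
  by (intro set_integrable_exp_decay continuous_lyap_flow exp_decay_lyap_flow)

lemma lyap_eq_flow: "lyap A V = (LINT t:{0..}|lborel. lyap_flow A V t)"
  by (simp add: lyap_def lyap_flow_def)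

lemma bounded_linear_lyapunov_operator:
  "bounded_linear (\<lambda>X. A ** X + X ** transpose A :: real^'n^'n)"
  by (intro bounded_linear_add matrix_mult_real.bounded_linear_left matrix_mult_real.bounded_linear_right)

text \<open>Under the integral sign the Lyapunov operator turns the flow into its own derivative,
  which integrates to minus the initial value \<open>V\<close>.\<close>

lemma lyap_equation:
  assumes "hurwitz A"
  shows "A ** lyap A V + lyap A V ** transpose A + V = 0"
proof -
  let ?T = "\<lambda>X. A ** X + X ** transpose A"
  have "?T (lyap A V) = (LINT t:{0..}|lborel. ?T (lyap_flow A V t))"
    unfolding lyap_eq_flow
    by (rule set_integral_bounded_linear[OF bounded_linear_lyapunov_operator
          set_integrable_lyap_flow[OF assms], symmetric])
  also have "\<dots> = - lyap_flow A V 0"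
    by (intro integral_derivative_exp_decay has_vector_derivative_lyap_flow exp_decay_lyap_flow assms
        exp_decay_bounded_linear[OF _ bounded_linear_lyapunov_operator]
        bounded_linear.continuous_on[OF bounded_linear_lyapunov_operator] continuous_lyap_flow)
  also have "\<dots> = - V" by (simp add: lyap_flow_def)
  finally show ?thesis by simp
qed

lemma transpose_lyap:
  assumes "hurwitz A"
  shows "transpose (lyap A V) = lyap A (transpose V)"
proof -
  have "transpose (lyap_flow A V t) = lyap_flow A (transpose V) t" for t
    by (simp add: lyap_flow_def matrix_transpose_mul mexp_transpose[symmetric] transpose_scalar matrix_mul_assoc)
  then show ?thesis
    unfolding lyap_eq_flow
      set_integral_bounded_linear[OF bounded_linear_transpose set_integrable_lyap_flow[OF assms], symmetric]
    by simp
qed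

text \<open>Conjugating \<open>D\<close> by the exponentials gives a curve with zero derivative that
  also decays. It is constantly zero, and at time 0 it equals \<open>D\<close>.\<close>

lemma lyapunov_homogeneous:
  fixes D :: "complex^'n^'n"
  assumes "hurwitz A" and D: "cmat A ** D + D ** cmat (transpose A) = 0"
  shows "D = 0"
proof -
  let ?X = "\<lambda>t. cmat (mexp (t *\<^sub>R A))" and ?Y = "\<lambda>t. cmat (mexp (t *\<^sub>R transpose A))"
  let ?f = "\<lambda>t. ?X t ** D ** ?Y t"
  have "(?f has_vector_derivative 0) (at t)" for t
  proof (rule has_vector_derivative_eq_rhs[OF matrix_mult_complex.has_vector_derivative[OF
        bounded_linear.has_vector_derivative[OF matrix_mult_complex.bounded_linear_left
          has_vector_derivative_cmat_mexp] has_vector_derivative_cmat_mexp]])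
    have "?X t ** D ** (?Y t ** cmat (transpose A)) + ?X t ** cmat A ** D ** ?Y t
        = ?X t ** (cmat A ** D + D ** cmat (transpose A)) ** ?Y t"
      by (simp add: matrix_mult_complex.add_left matrix_mult_complex.add_right matrix_mul_assoc
          cmat_mult[symmetric] mexp_scaleR_commute[symmetric])
        (simp add: cmat_mult matrix_mul_assoc add.commute)
    then show "?X t ** D ** (?Y t ** cmat (transpose A)) + ?X t ** cmat A ** D ** ?Y t = 0"
      by (simp add: D matrix_mult_complex.zero_left matrix_mult_complex.zero_right)
  qed
  then obtain c where c: "\<And>t. ?f t = c"
    using has_vector_derivative_zero_constant[of UNIV ?f] by auto
  have "exp_decay (\<lambda>t. ?X t ** D)"
    by (rule exp_decay_bounded_linear[OF exp_decay_mexp[OF assms(1)]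
          bounded_linear_compose[OF matrix_mult_complex.bounded_linear_left bounded_linear_cmat]])
  moreover have "exp_decay ?Y"
    using exp_decay_bounded_linear[OF exp_decay_mexp[OF assms(1)]
        bounded_linear_compose[OF bounded_linear_cmat bounded_linear_transpose]]
    by (simp add: mexp_transpose[symmetric] transpose_scalar)
  ultimately have "exp_decay ?f"
    by (rule exp_decay_bilinear[OF bounded_bilinear_matrix_mult])
  then have "((\<lambda>t. c) \<longlongrightarrow> 0) (at_top :: real filter)"
    unfolding c by (rule exp_decay_tendsto_zero)
  then have "c = 0" by (simp add: tendsto_const_iff)
  then show ?thesis using c[of 0] by simp
qed

text \<open>\<open>X\<close> is complex because it will be an integral along the imaginary axis,
  which is not known in advance to be a real matrix.\<close>

lemma lyap_unique:
  fixes X :: "complex^'n^'n"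
  assumes "hurwitz A" and X: "cmat A ** X + X ** cmat (transpose A) + cmat V = 0"
  shows "X = cmat (lyap A V)"
proof -
  have "cmat (A ** lyap A V + lyap A V ** transpose A + V) = 0"
    by (simp add: lyap_equation[OF assms(1)])
  then have "cmat A ** cmat (lyap A V) + cmat (lyap A V) ** cmat (transpose A) = - cmat V"
    by (simp only: cmat_add cmat_mult eq_neg_iff_add_eq_0)
  moreover have "cmat A ** X + X ** cmat (transpose A) = - cmat V"
    using X by (simp only: eq_neg_iff_add_eq_0)
  moreover have "cmat A ** (X - cmat (lyap A V)) + (X - cmat (lyap A V)) ** cmat (transpose A)
      = (cmat A ** X + X ** cmat (transpose A))
        - (cmat A ** cmat (lyap A V) + cmat (lyap A V) ** cmat (transpose A))"
    by (simp add: matrix_mult_complex.diff_left matrix_mult_complex.diff_right)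
  ultimately show ?thesis using lyapunov_homogeneous[OF assms(1), of "X - cmat (lyap A V)"] by simp
qed

lemma lyap_sym_invertible:
  fixes R :: "real^'m^'n"
  assumes "hurwitz A" "controllable A R"
  shows "transpose (lyap A (R ** transpose R)) = lyap A (R ** transpose R)"
    and "invertible (lyap A (R ** transpose R))"
proof -
  show "transpose (lyap A (R ** transpose R)) = lyap A (R ** transpose R)"
    by (simp add: transpose_lyap assms(1) matrix_transpose_mul)
  then show "invertible (lyap A (R ** transpose R))"
    by (rule invertible_if_lyapunov_controllable[OF lyap_equation[OF assms(1)] _ assms(2)])
qed

section \<open>Integrals along the imaginary axis\<close>

lemma
  shows integrable_inverse_one_plus_square: "integrable lborel (\<lambda>x::real. inverse (1 + x\<^sup>2))"
    and integral_inverse_one_plus_square: "(LINT x|lborel. inverse (1 + x\<^sup>2)) = pi"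
proof -
  have "einterval (- \<infinity>) \<infinity> = UNIV" by (auto simp: einterval_def)
  then show "integrable lborel (\<lambda>x::real. inverse (1 + x\<^sup>2))"
    and "(LINT x|lborel. inverse (1 + x\<^sup>2)) = pi"
    using integrable_inverse_1_plus_square LBINT_inverse_1_plus_square
    by (simp_all add: set_integrable_def interval_lebesgue_integral_def set_lebesgue_integral_def)
qed

lemma integrable_quadratic_decay:
  fixes g :: "real \<Rightarrow> 'a::{banach,second_countable_topology}"
  assumes "continuous_on UNIV g" and bound: "\<And>x. norm (g x) \<le> K / (1 + \<bar>x\<bar>)\<^sup>2"
  shows "integrable lborel g"
proof (rule Bochner_Integration.integrable_bound)
  show "integrable lborel (\<lambda>x. K * inverse (1 + x\<^sup>2))"
    by (intro integrable_mult_right integrable_inverse_one_plus_square)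
  show "g \<in> borel_measurable lborel"
    using borel_measurable_continuous_onI[OF assms(1)] by simp
  have "0 \<le> K" using order_trans[OF norm_ge_zero bound[of 0]] by simp
  have "norm (g x) \<le> norm (K * inverse (1 + x\<^sup>2))" for x
  proof -
    have "K / (1 + \<bar>x\<bar>)\<^sup>2 \<le> K / (1 + x\<^sup>2)"
      using \<open>0 \<le> K\<close> by (intro divide_left_mono) (auto simp: power2_sum intro!: add_pos_nonneg mult_pos_pos)
    then show ?thesis
      using bound[of x] \<open>0 \<le> K\<close> by (simp add: divide_inverse abs_mult)
  qed
  then show "AE x in lborel. norm (g x) \<le> norm (K * inverse (1 + x\<^sup>2))" by simp
qed

text \<open>Dominated convergence links the Lebesgue integral over the line to the integrals over
  segments that contour integration provides.\<close>

lemma integral_symmetric_intervals: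
  fixes g :: "real \<Rightarrow> 'a::euclidean_space"
  assumes cont: "continuous_on UNIV g" and int: "integrable lborel g"
  shows "((\<lambda>R. integral {-R..R} g) \<longlongrightarrow> integral\<^sup>L lborel g) at_top"
proof -
  have "((\<lambda>R. LINT x|lborel. indicator {-R..R} x *\<^sub>R g x) \<longlongrightarrow> integral\<^sup>L lborel g) at_top"
  proof (rule integral_dominated_convergence_at_top)
    show "integrable lborel (\<lambda>x. norm (g x))" using int by simp
    show "g \<in> borel_measurable lborel" using int by simp
    then show "(\<lambda>x. indicator {-R..R} x *\<^sub>R g x) \<in> borel_measurable lborel" for R :: real
      by simp
    have "((\<lambda>R. indicator {-R..R} x *\<^sub>R g x) \<longlongrightarrow> g x) at_top" for x
    proof (rule tendsto_eventually)
      show "eventually (\<lambda>R. indicator {-R..R} x *\<^sub>R g x = g x) at_top"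
        using eventually_ge_at_top[of "\<bar>x\<bar>"] by eventually_elim (auto simp: indicator_def)
    qed
    then show "AE x in lborel. ((\<lambda>R. indicator {-R..R} x *\<^sub>R g x) \<longlongrightarrow> g x) at_top" by simp
    show "eventually (\<lambda>R. AE x in lborel. norm (indicator {-R..R} x *\<^sub>R g x) \<le> norm (g x)) at_top"
      by (simp add: indicator_def)
  qed
  moreover have "(LINT x|lborel. indicator {-R..R} x *\<^sub>R g x) = integral {-R..R} g" for R
    using set_borel_integral_eq_integral(2)[OF borel_integrable_atLeastAtMost'[OF
          continuous_on_subset[OF cont subset_UNIV]], of "-R" R]
    by (simp add: set_lebesgue_integral_def)
  ultimately show ?thesis by simp
qed

text \<open>Close the segment from \<open>-iR\<close> to \<open>iR\<close> by a half circle in the right half plane; there the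
  integrand is \<open>O(R\<^sup>-\<^sup>2)\<close>.\<close>

lemma integral_imaginary_axis_eq_0:
  fixes f :: "complex \<Rightarrow> complex"
  assumes holo: "f holomorphic_on {s. 0 \<le> Re s}"
    and bound: "\<And>s. 0 \<le> Re s \<Longrightarrow> norm (f s) \<le> K / (1 + norm s)\<^sup>2"
  shows "(LINT w|lborel. f (\<i> * complex_of_real w)) = 0"
proof -
  let ?S = "{s::complex. 0 \<le> Re s}"
  let ?g = "\<lambda>w. f (\<i> * complex_of_real w)"
  have conv: "convex ?S" by (simp add: convex_halfspace_Re_ge)
  have contS: "continuous_on ?S f" using holo by (rule holomorphic_on_imp_continuous_on)
  have cont: "continuous_on UNIV ?g"
    by (rule continuous_on_compose2[OF contS]) (auto intro!: continuous_intros)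
  have int: "integrable lborel ?g"
    by (rule integrable_quadratic_decay[OF cont]) (use bound[of "\<i> * of_real w" for w] in \<open>simp add: norm_mult\<close>)
  have K: "0 \<le> K" using order_trans[OF norm_ge_zero bound[of 0]] by simp
  have arc: "norm (integral {-R..R} ?g) \<le> K / (1 + R)\<^sup>2 * R * pi" if R: "0 < R" for R
  proof -
    let ?arc = "part_circlepath 0 R (- (pi / 2)) (pi / 2)"
    let ?line = "linepath (Complex 0 (-R)) (Complex 0 R)"
    have ends: "pathstart ?arc = Complex 0 (-R)" "pathfinish ?arc = Complex 0 R"
      by (simp_all add: complex_eq_iff Re_exp Im_exp)
    have arc_sub: "path_image ?arc \<subseteq> ?S"
    proof -
      have "0 \<le> cos x" if "- (pi / 2) \<le> x" "x \<le> pi / 2" for x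
        using that by (intro cos_ge_zero) auto
      then show ?thesis using R by (auto simp: path_image_part_circlepath Re_exp)
    qed
    have line_sub: "path_image ?line \<subseteq> ?S"
      using closed_segment_subset[OF _ _ conv] by simp
    have "contour_integral ?arc f = contour_integral ?line f"
    proof -
      \<comment> \<open>The closed half plane is convex and \<open>f\<close> is holomorphic up to
        its boundary, so the closed contour may run along the axis itself.\<close>
      have "(f has_contour_integral 0) (?arc +++ reversepath ?line)"
      proof (rule Cauchy_theorem_convex_simple[OF holo conv])
        show "valid_path (?arc +++ reversepath ?line)"
          by (intro valid_path_join) (use ends in simp_all)
        show "path_image (?arc +++ reversepath ?line) \<subseteq> ?S"
          using arc_sub line_sub ends
          by (subst path_image_join) (simp_all add: closed_segment_commute[of "Complex 0 R"])
        show "pathfinish (?arc +++ reversepath ?line) = pathstart (?arc +++ reversepath ?line)"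
          using ends by simp
      qed
      moreover have ints: "f contour_integrable_on ?arc" "f contour_integrable_on ?line"
        using continuous_on_subset[OF contS arc_sub] continuous_on_subset[OF contS line_sub]
        by (auto intro: contour_integrable_continuous_part_circlepath contour_integrable_continuous_linepath)
      moreover have "f contour_integrable_on reversepath ?line"
        using ints(2) by (intro contour_integrable_reversepath) auto
      ultimately have "contour_integral ?arc f + contour_integral (reversepath ?line) f = 0"
        using contour_integral_unique[of f 0] ends
        by (subst contour_integral_join[symmetric]) auto
      then show ?thesis using contour_integral_reversepath[of ?line f] by simp
    qed
    moreover have "norm (contour_integral ?arc f) \<le> K / (1 + R)\<^sup>2 * R * \<bar>pi / 2 - - (pi / 2)\<bar>"
    proof (rule contour_integral_bound_part_circlepath)
      show "f contour_integrable_on ?arc"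
        using continuous_on_subset[OF contS arc_sub] by (rule contour_integrable_continuous_part_circlepath)
      show "norm (f s) \<le> K / (1 + R)\<^sup>2" if "s \<in> path_image ?arc" for s
        using bound[of s] in_path_image_part_circlepath[OF that] arc_sub that R by auto
    qed (use K R in auto)
    \<comment> \<open>Parametrising the segment by height contributes only a factor of modulus
      one.\<close>
    moreover have "norm (integral {-R..R} ?g) = norm (contour_integral ?line f)"
    proof -
      have "(f has_contour_integral contour_integral ?line f) ?line"
        using continuous_on_subset[OF contS line_sub]
        by (intro has_contour_integral_integral contour_integrable_continuous_linepath) simp
      then have "((\<lambda>x. f (Complex 0 x)) has_integral (- \<i> * contour_integral ?line f)) {-R..R}"
        by (subst (asm) has_contour_integral_linepath_same_Re_iff) (use R in auto)
      then have "integral {-R..R} ?g = - \<i> * contour_integral ?line f"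
        by (simp add: Complex_eq integral_unique)
      then show ?thesis by (simp add: norm_mult)
    qed
    ultimately show ?thesis by (simp add: field_simps)
  qed
  have "((\<lambda>R. integral {-R..R} ?g) \<longlongrightarrow> 0) at_top"
  proof (rule Lim_null_comparison)
    show "eventually (\<lambda>R. norm (integral {-R..R} ?g) \<le> K / (1 + R)\<^sup>2 * R * pi) at_top"
      using eventually_gt_at_top[of 0] by eventually_elim (rule arc)
    show "((\<lambda>R. K / (1 + R)\<^sup>2 * R * pi) \<longlongrightarrow> 0) at_top" by real_asymp
  qed
  then show ?thesis
    using integral_symmetric_intervals[OF cont int] tendsto_unique[OF trivial_limit_at_top_linorder] by blast
qed

section \<open>Decay of the resolvent\<close>

text \<open>The exponent \<open>k\<close> is the order of decay at infinity; the weight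
  \<open>1 + norm s\<close> avoids a singularity at 0. Holomorphy is imposed on entries because
  \<open>holomorphic_on\<close> concerns scalar functions.\<close>

definition half_plane_decay :: "nat \<Rightarrow> (complex \<Rightarrow> complex^'m^'n) \<Rightarrow> bool" where
  "half_plane_decay k F \<longleftrightarrow> (\<forall>i j. (\<lambda>s. F s $ i $ j) holomorphic_on {s. 0 \<le> Re s}) \<and>
     (\<exists>K. \<forall>s. 0 \<le> Re s \<longrightarrow> norm (F s) \<le> K / (1 + norm s) ^ k)"

lemma half_plane_decay_const: "half_plane_decay 0 (\<lambda>s. M)"
  unfolding half_plane_decay_def by auto

lemma half_plane_decay_mult:
  fixes F :: "complex \<Rightarrow> complex^'m^'n" and G :: "complex \<Rightarrow> complex^'p^'m"
  assumes "half_plane_decay k F" "half_plane_decay l G"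
  shows "half_plane_decay (k + l) (\<lambda>s. F s ** G s)"
proof -
  obtain K where K: "\<And>s. 0 \<le> Re s \<Longrightarrow> norm (F s) \<le> K / (1 + norm s) ^ k"
    using assms(1) by (auto simp: half_plane_decay_def)
  obtain L where L: "\<And>s. 0 \<le> Re s \<Longrightarrow> norm (G s) \<le> L / (1 + norm s) ^ l"
    using assms(2) by (auto simp: half_plane_decay_def)
  obtain H where H: "0 < H" "\<And>(X :: complex^'m^'n) (Y :: complex^'p^'m). norm (X ** Y) \<le> norm X * norm Y * H"
    using matrix_mult_complex.pos_bounded by blast
  have "norm (F s ** G s) \<le> (K * L * H) / (1 + norm s) ^ (k + l)" if s: "0 \<le> Re s" for s
  proof -
    have "norm (F s) * norm (G s) \<le> (K / (1 + norm s) ^ k) * (L / (1 + norm s) ^ l)"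
      using order_trans[OF norm_ge_zero K[OF s]] by (intro mult_mono K L s) auto
    then have "norm (F s ** G s) \<le> (K / (1 + norm s) ^ k) * (L / (1 + norm s) ^ l) * H"
      using H by (meson less_imp_le mult_right_mono order_trans)
    then show ?thesis by (simp add: power_add mult_ac)
  qed
  moreover have "(\<lambda>s. (F s ** G s) $ i $ j) holomorphic_on {s. 0 \<le> Re s}" for i j
    using assms unfolding matrix_matrix_mult_def half_plane_decay_def
    by (auto intro!: holomorphic_intros)
  ultimately show ?thesis unfolding half_plane_decay_def by blast
qed

lemma half_plane_decay_mono:
  assumes "half_plane_decay k F" "l \<le> k"
  shows "half_plane_decay l F"
proof -
  obtain K where K: "\<And>s. 0 \<le> Re s \<Longrightarrow> norm (F s) \<le> K / (1 + norm s) ^ k"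
    using assms(1) by (auto simp: half_plane_decay_def)
  have K0: "0 \<le> K" using order_trans[OF norm_ge_zero K[of 0]] by simp
  have "norm (F s) \<le> K / (1 + norm s) ^ l" if "0 \<le> Re s" for s
    by (rule order_trans[OF K[OF that]])
      (use assms(2) K0 in \<open>auto intro!: divide_left_mono power_increasing mult_pos_pos zero_less_power add_pos_nonneg\<close>)
  then show ?thesis using assms(1) unfolding half_plane_decay_def by blast
qed

lemma continuous_on_matrix:
  fixes F :: "'a::topological_space \<Rightarrow> complex^'m^'n"
  assumes "\<And>i j. continuous_on S (\<lambda>s. F s $ i $ j)"
  shows "continuous_on S F"
proof -
  have "continuous_on S (\<lambda>s. \<chi> i j. F s $ i $ j)"
    by (intro continuous_on_vec_lambda assms)
  then show ?thesis by simp
qed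

lemma half_plane_decay_continuous:
  assumes "half_plane_decay k F"
  shows "continuous_on {s. 0 \<le> Re s} F"
  using assms unfolding half_plane_decay_def
  by (intro continuous_on_matrix holomorphic_on_imp_continuous_on) blast

lemma half_plane_decay_axis:
  assumes "half_plane_decay k F"
  shows "continuous_on UNIV (\<lambda>w. F (\<i> * complex_of_real w))"
    and "\<exists>K\<ge>0. \<forall>w. norm (F (\<i> * complex_of_real w)) \<le> K / (1 + \<bar>w\<bar>) ^ k"
proof -
  show "continuous_on UNIV (\<lambda>w. F (\<i> * complex_of_real w))"
    by (rule continuous_on_compose2[OF half_plane_decay_continuous[OF assms]])
      (auto intro!: continuous_intros)
  obtain K where K: "\<And>s. 0 \<le> Re s \<Longrightarrow> norm (F s) \<le> K / (1 + norm s) ^ k"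
    using assms(1) by (auto simp: half_plane_decay_def)
  have "norm (F (\<i> * complex_of_real w)) \<le> K / (1 + \<bar>w\<bar>) ^ k" for w
    using K[of "\<i> * complex_of_real w"] by (simp add: norm_mult)
  moreover have "0 \<le> K" using order_trans[OF norm_ge_zero K[of 0]] by simp
  ultimately show "\<exists>K\<ge>0. \<forall>w. norm (F (\<i> * complex_of_real w)) \<le> K / (1 + \<bar>w\<bar>) ^ k" by blast
qed

lemma half_plane_decay_integrable:
  assumes "half_plane_decay 2 F"
  shows "integrable lborel (\<lambda>w. F (\<i> * complex_of_real w))"
proof -
  obtain K where "\<And>w. norm (F (\<i> * complex_of_real w)) \<le> K / (1 + \<bar>w\<bar>)\<^sup>2"
    using half_plane_decay_axis(2)[OF assms] by blast
  then show ?thesis by (rule integrable_quadratic_decay[OF half_plane_decay_axis(1)[OF assms]])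
qed

lemma half_plane_decay_integral_eq_0:
  assumes "half_plane_decay 2 F"
  shows "(LINT w|lborel. F (\<i> * complex_of_real w)) = 0"
proof -
  have nth: "bounded_linear (\<lambda>M :: complex^'a^'b. M $ i $ j)" for i j
    by (intro bounded_linear_compose[OF bounded_linear_vec_nth] bounded_linear_vec_nth)
  obtain K where K: "\<And>s. 0 \<le> Re s \<Longrightarrow> norm (F s) \<le> K / (1 + norm s)\<^sup>2"
    using assms by (auto simp: half_plane_decay_def)
  have "(LINT w|lborel. F (\<i> * complex_of_real w)) $ i $ j = 0" for i j
  proof -
    have "(LINT w|lborel. F (\<i> * complex_of_real w)) $ i $ j = (LINT w|lborel. F (\<i> * complex_of_real w) $ i $ j)"
      using integral_bounded_linear[OF nth half_plane_decay_integrable[OF assms]] by simp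
    also have "\<dots> = 0"
    proof (rule integral_imaginary_axis_eq_0)
      show "(\<lambda>s. F s $ i $ j) holomorphic_on {s. 0 \<le> Re s}"
        using assms by (simp add: half_plane_decay_def)
      show "norm (F s $ i $ j) \<le> K / (1 + norm s)\<^sup>2" if "0 \<le> Re s" for s
        using K[OF that] by (meson Finite_Cartesian_Product.norm_nth_le order_trans)
    qed
    finally show ?thesis .
  qed
  then show ?thesis by (simp add: vec_eq_iff)
qed

text \<open>Taking adjoints destroys holomorphy in \<open>s\<close>, so such products are treated
  only on the axis, where continuity survives and the orders of decay add up.\<close>

lemma half_plane_decay_integrable_ctranspose:
  fixes F :: "complex \<Rightarrow> complex^'m^'n" and G :: "complex \<Rightarrow> complex^'m^'p"
  assumes "half_plane_decay k F" "half_plane_decay l G" "2 \<le> k + l"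
  shows "integrable lborel (\<lambda>w. F (\<i> * complex_of_real w) ** ctranspose (G (\<i> * complex_of_real w)))"
proof -
  obtain K where K: "0 \<le> K" "\<And>w. norm (F (\<i> * complex_of_real w)) \<le> K / (1 + \<bar>w\<bar>) ^ k"
    using half_plane_decay_axis(2)[OF assms(1)] by blast
  obtain L where L: "0 \<le> L" "\<And>w. norm (G (\<i> * complex_of_real w)) \<le> L / (1 + \<bar>w\<bar>) ^ l"
    using half_plane_decay_axis(2)[OF assms(2)] by blast
  obtain H where H: "0 < H" "\<And>(X :: complex^'m^'n) (Y :: complex^'p^'m). norm (X ** Y) \<le> norm X * norm Y * H"
    using matrix_mult_complex.pos_bounded by blast
  show ?thesis
  proof (rule integrable_quadratic_decay)
    show "continuous_on UNIV (\<lambda>w. F (\<i> * complex_of_real w) ** ctranspose (G (\<i> * complex_of_real w)))"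
      by (intro matrix_mult_complex.continuous_on half_plane_decay_axis(1)[OF assms(1)]
          bounded_linear.continuous_on[OF bounded_linear_ctranspose] half_plane_decay_axis(1)[OF assms(2)])
    fix w
    let ?F = "F (\<i> * complex_of_real w)" and ?G = "G (\<i> * complex_of_real w)"
    have "norm ?F * norm ?G \<le> (K / (1 + \<bar>w\<bar>) ^ k) * (L / (1 + \<bar>w\<bar>) ^ l)"
      using K L by (intro mult_mono) auto
    also have "\<dots> = (K * L) / (1 + \<bar>w\<bar>) ^ (k + l)" by (simp add: power_add)
    also have "\<dots> \<le> (K * L) / (1 + \<bar>w\<bar>)\<^sup>2"
      using K(1) L(1) assms(3)
      by (auto intro!: divide_left_mono power_increasing mult_pos_pos zero_less_power add_pos_nonneg)
    finally have "norm ?F * norm ?G * H \<le> (K * L) / (1 + \<bar>w\<bar>)\<^sup>2 * H"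
      using H(1) by (intro mult_right_mono) auto
    then show "norm (?F ** ctranspose ?G) \<le> (K * L * H) / (1 + \<bar>w\<bar>)\<^sup>2"
      using H(2)[of ?F "ctranspose ?G"] by (simp add: norm_ctranspose)
  qed
qed

lemma holomorphic_det:
  assumes "\<And>i j. (\<lambda>s. M s $ i $ j) holomorphic_on S"
  shows "(\<lambda>s. det (M s)) holomorphic_on S"
  unfolding det_def by (intro holomorphic_intros assms)

lemma resolvent_inverse:
  assumes "hurwitz A" "0 \<le> Re s"
  shows "(mat s - cmat A) ** resolvent A s = mat 1" "resolvent A s ** (mat s - cmat A) = mat 1"
proof -
  have "invertible (mat s - cmat A)"
    using assms by (intro invertible_if_not_eigenvalue) (force simp: hurwitz_def)
  then show "(mat s - cmat A) ** resolvent A s = mat 1" "resolvent A s ** (mat s - cmat A) = mat 1"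
    unfolding resolvent_def by (rule matrix_inv_right_left)+
qed

text \<open>By Cramer's rule each entry is a quotient of determinants with holomorphic entries; the
  denominator has no zero in the half plane because \<open>A\<close> is Hurwitz.\<close>

lemma holomorphic_resolvent:
  assumes "hurwitz A"
  shows "(\<lambda>s. resolvent A s $ i $ j) holomorphic_on {s. 0 \<le> Re s}"
proof -
  let ?N = "\<lambda>s. (\<chi> r c. if c = i then (axis j 1 :: complex^_) $ r else (mat s - cmat A) $ r $ c)"
  have det: "det (mat s - cmat A) \<noteq> 0" if "0 \<le> Re s" for s
    using resolvent_inverse[OF assms that] invertible_det_nz unfolding invertible_def by blast
  have "resolvent A s $ i $ j = det (?N s) / det (mat s - cmat A)" if "0 \<le> Re s" for s
  proof -
    have "(mat s - cmat A) *v (resolvent A s *v axis j 1) = axis j 1"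
      by (simp add: matrix_vector_mul_assoc resolvent_inverse[OF assms that])
    then have "resolvent A s *v axis j 1 = (\<chi> k. det (\<chi> r c. if c = k then (axis j 1 :: complex^_) $ r
        else (mat s - cmat A) $ r $ c) / det (mat s - cmat A))"
      using cramer[OF det[OF that]] by blast
    then have "(resolvent A s *v axis j 1) $ i = det (?N s) / det (mat s - cmat A)"
      by (simp only: vec_lambda_beta)
    moreover have "(\<Sum>k\<in>UNIV. resolvent A s $ i $ k * axis j 1 $ k)
        = (\<Sum>k\<in>UNIV. if k = j then resolvent A s $ i $ k else 0)"
      by (rule sum.cong) (auto simp: axis_def)
    ultimately show ?thesis by (simp add: matrix_vector_mult_def)
  qed
  moreover have mat: "(\<lambda>s. (mat s - cmat A) $ r $ c) holomorphic_on {s. 0 \<le> Re s}" for r c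
    by (cases "r = c") (auto simp: mat_def intro!: holomorphic_intros)
  have "(\<lambda>s. det (?N s) / det (mat s - cmat A)) holomorphic_on {s. 0 \<le> Re s}"
  proof (intro holomorphic_on_divide holomorphic_det)
    show "(\<lambda>s. ?N s $ r $ c) holomorphic_on {s. 0 \<le> Re s}" for r c
      by (cases "c = i") (use mat in auto)
  qed (use mat det in auto)
  ultimately show ?thesis
    using holomorphic_cong[OF refl] by (metis (no_types, lifting) mem_Collect_eq)
qed

lemma norm_mat_mult: "norm (mat c ** M) = norm c * norm (M :: complex^'m^'n)"
proof -
  have "norm ((mat c ** M) $ i) = norm c * norm (M $ i)" for i
    by (simp add: norm_vec_def mat_mult_nth norm_mult L2_set_right_distrib)
  then show ?thesis
    by (simp add: norm_vec_def[where 'a = "complex^'m"] L2_set_right_distrib)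
qed

text \<open>For bounded \<open>s\<close> compactness suffices. For large \<open>s\<close>, the
  identity \<open>s E = I + A E\<close> gives \<open>(norm s - a) * norm E \<le> N\<close>, and
  \<open>norm s > 2 * a + 1\<close> makes \<open>1 + norm s\<close> at most twice
  \<open>norm s - a\<close>.\<close>

lemma half_plane_decay_resolvent:
  assumes "hurwitz A"
  shows "half_plane_decay 1 (resolvent A)"
proof -
  let ?E = "resolvent A"
  obtain H where H: "0 < H" "\<And>(X :: complex^'a^'a) (Y :: complex^'a^'a). norm (X ** Y) \<le> norm X * norm Y * H"
    using matrix_mult_complex.pos_bounded by blast
  define a where "a = norm (cmat A) * H"
  define N where "N = norm (mat 1 :: complex^'a^'a)"
  have a0: "0 \<le> a" using H by (simp add: a_def)
  let ?C = "cball 0 (2 * a + 1) \<inter> {s. 0 \<le> Re s}"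
  have "continuous_on {s. 0 \<le> Re s} ?E"
    by (intro continuous_on_matrix holomorphic_on_imp_continuous_on holomorphic_resolvent assms)
  then have "compact (?E ` ?C)"
    by (intro compact_continuous_image compact_Int_closed)
      (auto intro: continuous_on_subset closed_halfspace_Re_ge)
  then obtain L where L: "\<And>s. s \<in> ?C \<Longrightarrow> norm (?E s) \<le> L" and L0: "0 < L"
    using compact_imp_bounded bounded_pos by (metis (no_types, lifting) image_eqI)
  define K where "K = max (2 * N) (L * (2 * a + 2))"
  have "norm (?E s) \<le> K / (1 + norm s) ^ 1" if s: "0 \<le> Re s" for s
  proof (cases "norm s \<le> 2 * a + 1")
    case True
    have "norm (?E s) * (1 + norm s) \<le> L * (2 * a + 2)"
      using L[of s] s True L0 by (intro mult_mono) auto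
    also have "\<dots> \<le> K" by (simp add: K_def)
    finally show ?thesis by (simp add: field_simps add_pos_nonneg)
  next
    case False
    have "mat s ** ?E s = mat 1 + cmat A ** ?E s"
      using resolvent_inverse(1)[OF assms s] by (simp add: matrix_mult_complex.diff_left algebra_simps)
    then have "norm s * norm (?E s) \<le> N + norm (cmat A ** ?E s)"
      unfolding N_def by (metis norm_mat_mult norm_triangle_ineq)
    also have "\<dots> \<le> N + a * norm (?E s)"
      using H(2)[of "cmat A" "?E s"] by (simp add: a_def mult_ac)
    finally have "norm s * norm (?E s) - a * norm (?E s) \<le> N" by simp
    moreover have "(1 + norm s) * norm (?E s) \<le> (2 * norm s - 2 * a) * norm (?E s)"
      using False by (intro mult_right_mono) auto
    ultimately have "(1 + norm s) * norm (?E s) \<le> 2 * N"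
      by (simp add: algebra_simps)
    also have "\<dots> \<le> K" by (simp add: K_def)
    finally show ?thesis by (simp add: field_simps add_pos_nonneg)
  qed
  then show ?thesis
    unfolding half_plane_decay_def using holomorphic_resolvent[OF assms] by blast
qed

text \<open>On the axis \<open>s\<close> and its conjugate sum to zero, so adding \<open>s\<close>
  to both factors leaves the Lyapunov equation unchanged. This is the splitting of \<open>V\<close>
  required by \<open>spectral_factor_swap\<close>.\<close>

lemma lyap_spectral:
  assumes "hurwitz A"
  defines "M \<equiv> \<lambda>w. mat (\<i> * complex_of_real w) - cmat A"
  shows "cmat V = M w ** cmat (lyap A V) + cmat (lyap A V) ** ctranspose (M w)"
proof -
  have "cmat (A ** lyap A V + lyap A V ** transpose A + V) = 0"
    by (simp add: lyap_equation[OF assms(1)])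
  then have "cmat V = - (cmat A ** cmat (lyap A V) + cmat (lyap A V) ** cmat (transpose A))"
    by (simp add: cmat_add cmat_mult add_eq_0_iff)
  moreover have "mat (- (\<i> * complex_of_real w)) = - (mat (\<i> * complex_of_real w) :: complex^'a^'a)"
    by (simp add: vec_eq_iff mat_def)
  ultimately show ?thesis
    by (simp add: M_def ctranspose_diff matrix_mult_complex.diff_left matrix_mult_complex.diff_right
        matrix_mult_complex.minus_right mat_mult_commute)
qed

lemma resolvent_axis:
  fixes A :: "real^'n^'n"
  assumes "hurwitz A"
  defines "M \<equiv> \<lambda>w. mat (\<i> * complex_of_real w) - cmat A"
    and "E \<equiv> \<lambda>w. resolvent A (\<i> * complex_of_real w)"
  shows "E w ** M w = mat 1" "M w ** E w = mat 1"
    and "ctranspose (E w) ** ctranspose (M w) = mat 1" "ctranspose (M w) ** ctranspose (E w) = mat 1"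
  unfolding ctranspose_mult[symmetric]
  using resolvent_inverse[OF assms(1), of "\<i> * complex_of_real w"] by (simp_all add: M_def E_def)

text \<open>Near infinity \<open>E(s) = I / (1 + s) + O(s\<^sup>-\<^sup>2)\<close>, and only the first summand contributes.\<close>

lemma integral_resolvent_sandwich:
  fixes A V :: "real^'n^'n"
  assumes "hurwitz A"
  shows "(LINT w|lborel. resolvent A (\<i> * complex_of_real w) ** cmat V **
      ctranspose (resolvent A (\<i> * complex_of_real w))) = (2 * pi) *\<^sub>R cmat (lyap A V)"
proof -
  let ?s = "\<lambda>w. \<i> * complex_of_real w"
  let ?L = "cmat (lyap A V)"
  \<comment> \<open>The comparison function has an explicit integral and its pole at -1, outside the
    half plane. The error \<open>Q\<close> comes from \<open>(1 + s) E = I + E (I + A)\<close> and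
    is of order 2.\<close>
  define q where "q s = (mat (1 / (1 + s)) :: complex^'n^'n)" for s
  define Q where "Q s = resolvent A s ** (mat 1 + cmat A) ** q s" for s
  have nz: "1 + s \<noteq> 0" if "0 \<le> Re s" for s :: complex
    using that by (auto simp: complex_eq_iff)
  have split: "resolvent A s = q s + Q s" if "0 \<le> Re s" for s
  proof -
    have "resolvent A s ** mat (1 + s) = resolvent A s ** (mat s - cmat A) + resolvent A s ** (mat 1 + cmat A)"
      by (simp add: mat_add matrix_mult_complex.add_right matrix_mult_complex.diff_right)
    also have "\<dots> = mat 1 + resolvent A s ** (mat 1 + cmat A)"
      by (simp add: resolvent_inverse[OF assms that])
    finally have "(resolvent A s ** mat (1 + s)) ** q s = q s + Q s"
      by (simp add: Q_def matrix_mult_complex.add_left)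
    moreover have "(mat (1 + s) :: complex^'n^'n) ** q s = mat 1"
      using nz[OF that] by (simp add: q_def mat_mult_mat[symmetric])
    ultimately show ?thesis by (simp add: matrix_mul_assoc[symmetric])
  qed
  have q: "half_plane_decay 1 q"
    unfolding half_plane_decay_def
  proof (intro conjI allI exI impI)
    show "(\<lambda>s. q s $ i $ j) holomorphic_on {s. 0 \<le> Re s}" for i j
      by (cases "i = j") (auto simp: q_def mat_def nz intro!: holomorphic_intros)
    fix s :: complex assume s: "0 \<le> Re s"
    have "norm s \<le> norm (1 + s)"
      using s by (simp add: cmod_def power2_eq_square algebra_simps)
    moreover have "1 \<le> norm (1 + s)"
      using s complex_Re_le_cmod[of "1 + s"] by simp
    moreover have "1 / n \<le> 2 / (1 + t)" if "t \<le> n" "1 \<le> n" "0 \<le> t" for n t :: real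
      using that by (simp add: field_simps)
    ultimately have "1 / norm (1 + s) \<le> 2 / (1 + norm s)" by simp
    then have "1 / norm (1 + s) * norm (mat 1 :: complex^'n^'n) \<le> 2 / (1 + norm s) * norm (mat 1 :: complex^'n^'n)"
      by (rule mult_right_mono) simp
    then show "norm (q s) \<le> (2 * norm (mat 1 :: complex^'n^'n)) / (1 + norm s) ^ 1"
      using norm_mat_mult[of "1 / (1 + s)" "mat 1 :: complex^'n^'n"] by (simp add: q_def norm_divide)
  qed
  have "half_plane_decay ((1 + 0) + 1) Q"
    unfolding Q_def
    by (intro half_plane_decay_mult half_plane_decay_const half_plane_decay_resolvent q assms)
  then have Q: "half_plane_decay 2 Q" by (simp add: numeral_2_eq_2)
  let ?T = "\<lambda>X. ?L ** ctranspose X + X ** ?L"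
  have T: "bounded_linear ?T"
    by (intro bounded_linear_add matrix_mult_complex.bounded_linear_left
        bounded_linear_compose[OF matrix_mult_complex.bounded_linear_right bounded_linear_ctranspose])
  \<comment> \<open>The sandwich equals \<open>?T E\<close>, which depends real-linearly on the
    resolvent; splitting \<open>E = q + Q\<close> leaves the scalar
    \<open>2 Re (1 / (1 + iw)) = 2 / (1 + w^2)\<close> as the main term.\<close>
  have "resolvent A (?s w) ** cmat V ** ctranspose (resolvent A (?s w))
      = ?T (Q (?s w)) + inverse (1 + w\<^sup>2) *\<^sub>R (2 *\<^sub>R ?L)" for w
  proof -
    let ?M = "mat (?s w) - cmat A" and ?E = "resolvent A (?s w)"
    have "?E ** cmat V ** ctranspose ?E = ?E ** (?M ** ?L) ** ctranspose ?E + ?E ** (?L ** ctranspose ?M) ** ctranspose ?E"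
      unfolding lyap_spectral[OF assms, of V w]
      by (simp add: matrix_mult_complex.add_left matrix_mult_complex.add_right)
    also have "?E ** (?M ** ?L) = ?L"
      by (simp add: matrix_mul_assoc resolvent_axis(1)[OF assms])
    also have "?E ** (?L ** ctranspose ?M) ** ctranspose ?E = ?E ** ?L"
      by (simp add: matrix_mul_assoc[symmetric] resolvent_axis(4)[OF assms])
    also have "?L ** ctranspose ?E + ?E ** ?L = ?T (Q (?s w)) + ?T (q (?s w))"
      by (simp add: split ctranspose_add matrix_mult_complex.add_left matrix_mult_complex.add_right)
    also have "?T (q (?s w)) = mat (cnj (1 / (1 + ?s w)) + 1 / (1 + ?s w)) ** ?L"
      by (simp add: q_def mat_add matrix_mult_complex.add_left mat_mult_commute)
    also have "cnj (1 / (1 + ?s w)) + 1 / (1 + ?s w) = complex_of_real (2 * inverse (1 + w\<^sup>2))"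
    proof -
      have "0 < 1 + w\<^sup>2" by (simp add: add_pos_nonneg)
      then show ?thesis
        by (simp add: complex_eq_iff Re_divide Im_divide power2_eq_square divide_inverse)
    qed
    finally show ?thesis by (simp only: mat_of_real_mult) (simp add: mult.commute)
  qed
  then have "(LINT w|lborel. resolvent A (?s w) ** cmat V ** ctranspose (resolvent A (?s w)))
      = (LINT w|lborel. ?T (Q (?s w)) + inverse (1 + w\<^sup>2) *\<^sub>R (2 *\<^sub>R ?L))"
    by (simp only:)
  also have "\<dots> = (LINT w|lborel. ?T (Q (?s w))) + (LINT w|lborel. inverse (1 + w\<^sup>2) *\<^sub>R (2 *\<^sub>R ?L))"
    by (intro Bochner_Integration.integral_add integrable_bounded_linear[OF T]
        half_plane_decay_integrable[OF Q] integrable_scaleR_left integrable_inverse_one_plus_square)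
  also have "(LINT w|lborel. ?T (Q (?s w))) = ?T (LINT w|lborel. Q (?s w))"
    by (rule integral_bounded_linear[OF T half_plane_decay_integrable[OF Q]])
  also have "\<dots> = ?T 0"
    by (simp only: half_plane_decay_integral_eq_0[OF Q])
  also have "?T 0 = 0"
    by (rule linear_0[OF bounded_linear.linear[OF T]])
  also have "(LINT w|lborel. inverse (1 + w\<^sup>2) *\<^sub>R (2 *\<^sub>R ?L)) = pi *\<^sub>R (2 *\<^sub>R ?L)"
    using integrable_inverse_one_plus_square
    by (simp only: integral_scaleR_left integral_inverse_one_plus_square)
  finally show ?thesis by (simp add: mult.commute)
qed

text \<open>The terms with \<open>iw\<close> cancel in \<open>Z\<close>, leaving minus the Lyapunov
  operator of \<open>X\<close>. That operator is bounded and passes through the integral, and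
  uniqueness identifies the result.\<close>

lemma integral_axis_lyap:
  fixes A :: "real^'n^'n" and X Z :: "real \<Rightarrow> complex^'n^'n"
  assumes "hurwitz A" and X: "integrable lborel X"
    and Z: "\<And>w. (mat (\<i> * complex_of_real w) - cmat A) ** X w
      + X w ** ctranspose (mat (\<i> * complex_of_real w) - cmat A) = Z w"
    and Z_int: "(LINT w|lborel. Z w) = (2 * pi) *\<^sub>R cmat V"
  shows "(LINT w|lborel. X w) = (2 * pi) *\<^sub>R cmat (lyap A V)"
proof -
  let ?T = "\<lambda>X. cmat A ** X + X ** cmat (transpose A)"
  let ?I = "LINT w|lborel. X w"
  have T: "bounded_linear ?T"
    by (intro bounded_linear_add matrix_mult_complex.bounded_linear_left matrix_mult_complex.bounded_linear_right)
  have "mat (- (\<i> * complex_of_real w)) = - (mat (\<i> * complex_of_real w) :: complex^'n^'n)" for w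
    by (simp add: vec_eq_iff mat_def)
  then have "Z w = - ?T (X w)" for w
    unfolding Z[symmetric]
    by (simp add: ctranspose_diff matrix_mult_complex.diff_left matrix_mult_complex.diff_right
        matrix_mult_complex.minus_right mat_mult_commute)
  then have "(LINT w|lborel. Z w) = - (LINT w|lborel. ?T (X w))"
    by (simp only: Bochner_Integration.integral_minus)
  also have "\<dots> = - ?T ?I" by (simp only: integral_bounded_linear[OF T X])
  finally have TI: "?T ?I = - ((2 * pi) *\<^sub>R cmat V)" unfolding Z_int by simp
  have "?T ((1 / (2 * pi)) *\<^sub>R ?I) = (1 / (2 * pi)) *\<^sub>R ?T ?I"
    by (rule linear_cmul[OF bounded_linear.linear[OF T]])
  then have "?T ((1 / (2 * pi)) *\<^sub>R ?I) + cmat V = 0" unfolding TI by simp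
  then have "(1 / (2 * pi)) *\<^sub>R ?I = cmat (lyap A V)" by (rule lyap_unique[OF assms(1)])
  then have "(2 * pi) *\<^sub>R cmat (lyap A V) = (2 * pi) *\<^sub>R ((1 / (2 * pi)) *\<^sub>R ?I)" by simp
  then show ?thesis by simp
qed

section \<open>The recursion\<close>

lemma transpose_Omega: "transpose (transpose C ** C) = transpose C ** (C :: real^'n^'p)"
  by (simp add: matrix_transpose_mul)

text \<open>The convention that \<open>beta\<close> is the identity at 0 makes the formula uniform
  down to the first index.\<close>

lemma alpha_Suc: "alpha A B C (Suc j) = gamma A B C j ** beta A B C j"
  by (cases j) simp_all

lemma half_plane_decay_cascade:
  assumes "hurwitz A"
  shows "half_plane_decay k (cascade A B C k)"
proof (induction k)
  case 0
  show ?case using half_plane_decay_const[of "mat 1"] by simp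
next
  case (Suc k)
  have "half_plane_decay ((1 + 0) + k) (\<lambda>s. (resolvent A s ** cmat (alpha A B C (Suc k))) ** cascade A B C k s)"
    by (intro half_plane_decay_mult half_plane_decay_const half_plane_decay_resolvent assms Suc)
  then show ?case by simp
qed

definition cascade_gram :: "real^'n^'n \<Rightarrow> real^'m^'n \<Rightarrow> real^'n^'p \<Rightarrow> nat \<Rightarrow> nat \<Rightarrow> real \<Rightarrow> complex^'n^'n" where
  "cascade_gram A B C j k w = cascade A B C j (\<i> * complex_of_real w) ** cmat (transpose C ** C)
     ** ctranspose (cascade A B C k (\<i> * complex_of_real w))"

lemma ctranspose_cascade_gram: "ctranspose (cascade_gram A B C j k w) = cascade_gram A B C k j w"
  by (simp add: cascade_gram_def ctranspose_mult transpose_Omega matrix_mul_assoc)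

lemma integrable_cascade_gram:
  assumes "hurwitz A" "2 \<le> j + k"
  shows "integrable lborel (cascade_gram A B C j k)"
proof -
  have "half_plane_decay (j + 0) (\<lambda>s. cascade A B C j s ** cmat (transpose C ** C))"
    by (intro half_plane_decay_mult half_plane_decay_const half_plane_decay_cascade assms(1))
  from half_plane_decay_integrable_ctranspose[OF this half_plane_decay_cascade[OF assms(1)], of k]
  show ?thesis using assms(2) unfolding cascade_gram_def[abs_def] by simp
qed

text \<open>Multiplication by \<open>s - A\<close> cancels the outermost resolvent of a cascade and
  exposes its \<open>alpha\<close>; on the right the adjoint does the same.\<close>

lemma cascade_gram_lyap:
  assumes "hurwitz A"
  shows "(mat (\<i> * complex_of_real w) - cmat A) ** cascade_gram A B C (Suc j) (Suc k) w
      + cascade_gram A B C (Suc j) (Suc k) w ** ctranspose (mat (\<i> * complex_of_real w) - cmat A)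
    = cmat (alpha A B C (Suc j)) ** cascade_gram A B C j (Suc k) w
      + cascade_gram A B C (Suc j) k w ** cmat (transpose (alpha A B C (Suc k)))"
proof -
  let ?s = "\<i> * complex_of_real w"
  let ?M = "mat ?s - cmat A"
  let ?H = "\<lambda>k. cascade A B C k ?s"
  have H: "?M ** ?H (Suc k) = cmat (alpha A B C (Suc k)) ** ?H k" for k
    by (simp add: matrix_mul_assoc resolvent_axis(2)[OF assms])
  have "ctranspose (?H (Suc k)) ** ctranspose ?M = ctranspose (?H k) ** cmat (transpose (alpha A B C (Suc k)))"
    unfolding ctranspose_mult[symmetric] H by (simp add: ctranspose_mult)
  then have "cascade_gram A B C (Suc j) (Suc k) w ** ctranspose ?M
      = cascade_gram A B C (Suc j) k w ** cmat (transpose (alpha A B C (Suc k)))"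
    unfolding cascade_gram_def by (simp only: matrix_mul_assoc[symmetric])
  moreover have "?M ** cascade_gram A B C (Suc j) (Suc k) w
      = cmat (alpha A B C (Suc j)) ** cascade_gram A B C j (Suc k) w"
    unfolding cascade_gram_def by (simp only: matrix_mul_assoc H[unfolded matrix_mul_assoc])
  ultimately show ?thesis by simp
qed

text \<open>Induction on \<open>j + k\<close>: integrating \<open>cascade_gram_lyap\<close> gives a
  Lyapunov equation whose inhomogeneity involves only index pairs of smaller sum.\<close>

lemma integral_cascade_gram:
  fixes A :: "real^'n^'n" and B :: "real^'m^'n" and C :: "real^'n^'p"
  assumes "hurwitz A" "1 \<le> j" "j \<le> k"
  shows "(LINT w|lborel. cascade_gram A B C j k w) = (2 * pi) *\<^sub>R cmat (Pmat A B C j k)"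
  using assms(2,3)
proof (induction "j + k" arbitrary: j k rule: less_induct)
  case less
  let ?X = "cascade_gram A B C"
  note int = integrable_cascade_gram[OF assms(1)]
  show ?case
  proof (cases "k = 1")
    case True
    then have [simp]: "j = 1" using less.prems by simp
    have sym: "transpose (ctr_gram A B) = ctr_gram A B"
      unfolding ctr_gram_def by (simp add: transpose_lyap assms(1) matrix_transpose_mul)
    \<comment> \<open>The pair (1,1) is computed directly: its predecessors (0,1) and (1,0) have
      decay of order 1 only, too little for \<open>integrable_cascade_gram\<close>.\<close>
    have "?X 1 1 w = resolvent A (\<i> * complex_of_real w) **
        cmat (ctr_gram A B ** (transpose C ** C) ** ctr_gram A B) **
        ctranspose (resolvent A (\<i> * complex_of_real w))" for w
      by (simp add: cascade_gram_def ctranspose_mult cmat_mult matrix_mul_assoc sym)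
    then have "(LINT w|lborel. ?X 1 1 w) = (2 * pi) *\<^sub>R cmat (lyap A (ctr_gram A B ** (transpose C ** C) ** ctr_gram A B))"
      by (simp only: integral_resolvent_sandwich[OF assms(1)])
    then show ?thesis
      using True by (simp add: Pmat.simps[of A B C 1 1] Pmat.simps[of A B C "Suc 0" "Suc 0"] Omega_delta_def)
  next
    case False
    then obtain k' where k: "k = Suc k'" "1 \<le> k'" using less.prems by (cases k) auto
    obtain j' where j: "j = Suc j'" using less.prems by (cases j) auto
    let ?a = "cmat (alpha A B C j)" and ?b = "cmat (transpose (alpha A B C k))"
    have int1: "integrable lborel (?X j' k)" and int2: "integrable lborel (?X j k')"
      by (rule int, use k j in simp)+
    have Z: "(LINT w|lborel. ?a ** ?X j' k w + ?X j k' w ** ?b)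
        = ?a ** (LINT w|lborel. ?X j' k w) + (LINT w|lborel. ?X j k' w) ** ?b"
      by (simp only: Bochner_Integration.integral_add[OF
            integrable_bounded_linear[OF matrix_mult_complex.bounded_linear_right int1]
            integrable_bounded_linear[OF matrix_mult_complex.bounded_linear_left int2]]
          integral_bounded_linear[OF matrix_mult_complex.bounded_linear_right int1]
          integral_bounded_linear[OF matrix_mult_complex.bounded_linear_left int2])
    have X: "(LINT w|lborel. ?X j k w) = (2 * pi) *\<^sub>R cmat (lyap A V)"
      if "?a ** (LINT w|lborel. ?X j' k w) + (LINT w|lborel. ?X j k' w) ** ?b = (2 * pi) *\<^sub>R cmat V" for V
    proof (rule integral_axis_lyap[OF assms(1)])
      show "integrable lborel (?X j k)" by (rule int) (use less.prems in simp)
      show "(mat (\<i> * complex_of_real w) - cmat A) ** ?X j k w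
          + ?X j k w ** ctranspose (mat (\<i> * complex_of_real w) - cmat A)
          = ?a ** ?X j' k w + ?X j k' w ** ?b" for w
        using cascade_gram_lyap[OF assms(1), of w B C j' k'] by (simp only: j k)
    qed (use Z that in simp)
    note scaleR = matrix_mult_complex.scaleR_left matrix_mult_complex.scaleR_right
      scaleR_right_distrib[symmetric] cmat_mult[symmetric] cmat_add[symmetric]
    consider "j = 1" | "1 < j" "j < k" | "1 < j" "j = k" using less.prems by linarith
    then show ?thesis
    proof cases
      case 1
      \<comment> \<open>The predecessor (0,k) integrates to zero by Cauchy's theorem, which is why
        the first row of \<open>Pmat\<close> has a single term.\<close>
      have "half_plane_decay 2 (cascade A B C k)"
        by (rule half_plane_decay_mono[OF half_plane_decay_cascade[OF assms(1)]]) (use k in simp)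
      then have H: "integrable lborel (\<lambda>w. cascade A B C k (\<i> * complex_of_real w))"
        "(LINT w|lborel. cascade A B C k (\<i> * complex_of_real w)) = 0"
        by (rule half_plane_decay_integrable half_plane_decay_integral_eq_0)+
      let ?T = "\<lambda>H. cmat (transpose C ** C) ** ctranspose H"
      have T: "bounded_linear ?T"
        by (intro bounded_linear_compose[OF matrix_mult_complex.bounded_linear_right bounded_linear_ctranspose])
      have "(LINT w|lborel. ?X j' k w) = ?T 0"
        using integral_bounded_linear[OF T H(1)] 1 j by (simp add: cascade_gram_def H(2))
      also have "\<dots> = 0" by (rule linear_0[OF bounded_linear.linear[OF T]])
      finally have 0: "(LINT w|lborel. ?X j' k w) = 0" .
      have "(LINT w|lborel. ?X j k' w) = (2 * pi) *\<^sub>R cmat (Pmat A B C j k')"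
        using less.hyps[of j k'] less.prems 1 k by simp
      then have "?a ** (LINT w|lborel. ?X j' k w) + (LINT w|lborel. ?X j k' w) ** ?b
          = (2 * pi) *\<^sub>R cmat (Pmat A B C j k' ** transpose (alpha A B C k))"
        by (simp add: 0 matrix_mult_complex.zero_right scaleR)
      moreover have "Pmat A B C j k = lyap A (Pmat A B C j k' ** transpose (alpha A B C k))"
        using 1 k by (subst Pmat.simps) simp
      ultimately show ?thesis by (simp only: X)
    next
      case 2
      have "(LINT w|lborel. ?X j' k w) = (2 * pi) *\<^sub>R cmat (Pmat A B C j' k)"
        "(LINT w|lborel. ?X j k' w) = (2 * pi) *\<^sub>R cmat (Pmat A B C j k')"
        using less.hyps[of j' k] less.hyps[of j k'] 2 j k by simp_all
      then have "?a ** (LINT w|lborel. ?X j' k w) + (LINT w|lborel. ?X j k' w) ** ?b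
          = (2 * pi) *\<^sub>R cmat (alpha A B C j ** Pmat A B C j' k + Pmat A B C j k' ** transpose (alpha A B C k))"
        by (simp only: scaleR)
      moreover have "Pmat A B C j k
          = lyap A (alpha A B C j ** Pmat A B C j' k + Pmat A B C j k' ** transpose (alpha A B C k))"
        using 2 j k by (subst Pmat.simps) simp
      ultimately show ?thesis by (simp only: X)
    next
      case 3
      have I: "(LINT w|lborel. ?X j' k w) = (2 * pi) *\<^sub>R cmat (Pmat A B C j' k)"
        using less.hyps[of j' k] 3 j by simp
      \<comment> \<open>On the diagonal this predecessor lies below the diagonal, where
        \<open>Pmat\<close> is undefined; it is the adjoint of the one above.\<close>
      have "(LINT w|lborel. ?X j k' w) = (LINT w|lborel. ctranspose (?X j' k w))"
        using 3 j k by (simp add: ctranspose_cascade_gram)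
      also have "\<dots> = ctranspose (LINT w|lborel. ?X j' k w)"
        by (rule integral_bounded_linear[OF bounded_linear_ctranspose int1])
      finally have "(LINT w|lborel. ?X j k' w) = (2 * pi) *\<^sub>R cmat (transpose (Pmat A B C j' k))"
        by (simp add: I ctranspose_scaleR)
      then have "?a ** (LINT w|lborel. ?X j' k w) + (LINT w|lborel. ?X j k' w) ** ?b
          = (2 * pi) *\<^sub>R cmat (alpha A B C j ** Pmat A B C j' k + transpose (Pmat A B C j' k) ** transpose (alpha A B C k))"
        by (simp only: scaleR I)
      moreover have "Pmat A B C j k
          = lyap A (alpha A B C j ** Pmat A B C j' k + transpose (Pmat A B C j' k) ** transpose (alpha A B C k))"
        using 3 j k by (subst Pmat.simps) simp
      ultimately show ?thesis by (simp only: X)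
    qed
  qed
qed

section \<open>Factorisation of \<open>beta\<close> and invertibility of
  \<open>gamma\<close>\<close>

text \<open>The two shapes of \<open>rho\<close> have different types, hence the case distinction in
  the factorisation.\<close>

definition gram_factor :: "real^'n^'n \<Rightarrow> real^'m^'n + real^'p^'n \<Rightarrow> bool" where
  "gram_factor M r \<longleftrightarrow> (case r of Inl R \<Rightarrow> M = R ** transpose R | Inr R \<Rightarrow> M = R ** transpose R)"

lemma gram_factor_sym: "gram_factor M r \<Longrightarrow> transpose M = M"
  by (auto simp: gram_factor_def matrix_transpose_mul split: sum.splits)

text \<open>Matches the recursion of \<open>rho\<close>, with \<open>N\<close> the product of an
  inverse \<open>gamma\<close> and its predecessor.\<close>

lemma gram_factor_congruence:
  assumes "gram_factor M r"
  shows "gram_factor (N ** M ** transpose N) (map_sum (\<lambda>R. N ** R) (\<lambda>R. N ** R) r)"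
  using assms by (auto simp: gram_factor_def matrix_transpose_mul matrix_mul_assoc split: sum.splits)

locale controllable_recursion =
  fixes A :: "real^'n^'n" and B :: "real^'m^'n" and C :: "real^'n^'p"
  assumes hurwitz: "hurwitz A"
    and controllable_B: "controllable A B"
    and controllable_C: "controllable A (ctr_gram A B ** transpose C)"
    and controllable_rho: "\<And>j. 1 \<le> j \<Longrightarrow>
      (case rho A B C j of
         Inl R \<Rightarrow> controllable A (gamma A B C j ** R)
       | Inr R \<Rightarrow> controllable A (gamma A B C j ** R))"
begin

abbreviation "\<alpha> \<equiv> alpha A B C"
abbreviation "\<beta> \<equiv> beta A B C"
abbreviation "\<gamma> \<equiv> gamma A B C"

text \<open>With \<open>alpha\<close> eliminated the inhomogeneity is a congruence of
  \<open>\<beta>\<close>, so a factorisation of \<open>\<beta>\<close> makes it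
  \<open>R ** transpose R\<close>.\<close>

lemma gamma_Suc_Suc: "\<gamma> (Suc (Suc j)) = lyap A (\<gamma> (Suc j) ** \<beta> (Suc j) ** \<gamma> (Suc j))"
  by (simp add: Omega_delta_def)

lemma gamma_1: "\<gamma> (Suc 0) = lyap A (\<gamma> 0 ** (transpose C ** C) ** \<gamma> 0)"
  by (simp add: Omega_delta_def)

lemma beta_Suc_Suc_Suc: "\<beta> (Suc (Suc (Suc j))) =
    matrix_inv (\<gamma> (Suc (Suc j))) ** (\<gamma> (Suc j) ** \<beta> (Suc j) ** \<gamma> (Suc j)) ** matrix_inv (\<gamma> (Suc (Suc j)))"
  by (simp add: Omega_delta_def matrix_mul_assoc)

lemma beta_2: "\<beta> (Suc (Suc 0)) =
    matrix_inv (\<gamma> (Suc 0)) ** (\<gamma> 0 ** (transpose C ** C) ** \<gamma> 0) ** matrix_inv (\<gamma> (Suc 0))"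
  by (simp add: Omega_delta_def matrix_mul_assoc)

text \<open>The three claims need each other: for \<open>j \<ge> 2\<close>, the factor of
  \<open>\<beta> (j - 1)\<close> and symmetry of \<open>\<gamma> (j - 1)\<close> give symmetry and
  invertibility of \<open>\<gamma> j\<close>, and these give the factor of
  \<open>\<beta> (j + 1)\<close>. As \<open>rho\<close> advances by two indices, there are two base
  cases, starting from \<open>B\<close> and from \<open>C\<close>.\<close>

lemma gamma_beta_invariant:
  "transpose (\<gamma> j) = \<gamma> j \<and> invertible (\<gamma> j) \<and> gram_factor (\<beta> (Suc j)) (rho A B C (Suc j))"
proof (induction j rule: less_induct)
  case (less j)
  have inv_sym: "transpose (matrix_inv X) = matrix_inv X"
    if "transpose X = X" "invertible X" for X :: "real^'n^'n"
    using transpose_matrix_inv[OF that(2)] that(1) by simp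
  consider "j = 0" | "j = Suc 0" | i where "j = Suc (Suc i)" by (metis not0_implies_Suc)
  then show ?case
  proof cases
    case 1
    have P: "transpose (\<gamma> 0) = \<gamma> 0" "invertible (\<gamma> 0)"
      using lyap_sym_invertible[OF hurwitz controllable_B] by (simp_all add: ctr_gram_def)
    then show ?thesis
      using 1 by (simp add: gram_factor_def matrix_transpose_mul inv_sym matrix_mul_assoc)
  next
    case 2
    then have P: "transpose (\<gamma> 0) = \<gamma> 0" using less[of 0] by simp
    have "\<gamma> 0 ** (transpose C ** C) ** \<gamma> 0 = (\<gamma> 0 ** transpose C) ** transpose (\<gamma> 0 ** transpose C)"
      unfolding matrix_transpose_mul P by (simp add: matrix_mul_assoc)
    then have g: "transpose (\<gamma> (Suc 0)) = \<gamma> (Suc 0)" "invertible (\<gamma> (Suc 0))"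
      unfolding gamma_1 using lyap_sym_invertible[OF hurwitz controllable_C] by simp_all
    have "gram_factor (\<beta> (Suc (Suc 0))) (rho A B C (Suc (Suc 0)))"
      unfolding beta_2 using P
      by (simp add: gram_factor_def matrix_transpose_mul inv_sym[OF g] matrix_mul_assoc del: gamma.simps(2))
    then show ?thesis using 2 g by (simp del: gamma.simps beta.simps rho.simps)
  next
    case 3
    let ?g = "\<gamma> (Suc i)" and ?b = "\<beta> (Suc i)"
    have g': "transpose ?g = ?g" using less[of "Suc i"] 3 by blast
    have factor: "gram_factor ?b (rho A B C (Suc i))" using less[of i] 3 by simp
    have "transpose (\<gamma> (Suc (Suc i))) = \<gamma> (Suc (Suc i)) \<and> invertible (\<gamma> (Suc (Suc i)))"
    proof (cases "rho A B C (Suc i)")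
      case (Inl R)
      then have "?g ** ?b ** ?g = (?g ** R) ** transpose (?g ** R)"
        using factor by (simp add: gram_factor_def matrix_transpose_mul g' matrix_mul_assoc del: beta.simps gamma.simps)
      then show ?thesis
        unfolding gamma_Suc_Suc using lyap_sym_invertible[OF hurwitz, of "?g ** R"] controllable_rho[of "Suc i"] Inl
        by (simp del: beta.simps gamma.simps)
    next
      case (Inr R)
      then have "?g ** ?b ** ?g = (?g ** R) ** transpose (?g ** R)"
        using factor by (simp add: gram_factor_def matrix_transpose_mul g' matrix_mul_assoc del: beta.simps gamma.simps)
      then show ?thesis
        unfolding gamma_Suc_Suc using lyap_sym_invertible[OF hurwitz, of "?g ** R"] controllable_rho[of "Suc i"] Inr
        by (simp del: beta.simps gamma.simps)
    qed
    moreover from this have "gram_factor (\<beta> (Suc (Suc (Suc i)))) (rho A B C (Suc (Suc (Suc i))))"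
      unfolding beta_Suc_Suc_Suc
      using gram_factor_congruence[OF factor, of "matrix_inv (\<gamma> (Suc (Suc i))) ** ?g"]
      by (simp add: Let_def matrix_transpose_mul inv_sym g' matrix_mul_assoc del: beta.simps gamma.simps)
    ultimately show ?thesis using 3 by blast
  qed
qed

lemma gamma_sym: "transpose (\<gamma> j) = \<gamma> j"
  and gamma_invertible: "invertible (\<gamma> j)"
  and beta_factor: "gram_factor (\<beta> (Suc j)) (rho A B C (Suc j))"
  and beta_sym: "transpose (\<beta> (Suc j)) = \<beta> (Suc j)"
  using gamma_beta_invariant gram_factor_sym by blast+

text \<open>When \<open>V\<close> is the inhomogeneity that defines \<open>\<gamma> j\<close>, the
  matrix between the inner resolvents is \<open>\<beta> (Suc j)\<close>.\<close>

lemma resolvent_sandwich_swap: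
  assumes "\<gamma> j = lyap A V"
  defines "E \<equiv> \<lambda>w. resolvent A (\<i> * complex_of_real w)"
  shows "E w ** cmat V ** ctranspose (E w) = cmat (\<gamma> j) **
    (ctranspose (E w) ** cmat (matrix_inv (\<gamma> j) ** V ** matrix_inv (\<gamma> j)) ** E w) ** cmat (\<gamma> j)"
proof -
  let ?M = "mat (\<i> * complex_of_real w) - cmat A"
  have "cmat (\<gamma> j) ** cmat (matrix_inv (\<gamma> j)) = mat 1" "cmat (matrix_inv (\<gamma> j)) ** cmat (\<gamma> j) = mat 1"
    by (simp_all only: cmat_mult[symmetric] matrix_inv_right_left[OF gamma_invertible] cmat_mat of_real_1)
  moreover have "cmat V = ?M ** cmat (\<gamma> j) + cmat (\<gamma> j) ** ctranspose ?M"
    unfolding assms(1) by (rule lyap_spectral[OF hurwitz])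
  ultimately show ?thesis
    unfolding E_def cmat_mult by (intro spectral_factor_swap(2)[OF resolvent_axis[OF hurwitz]])
qed

lemma trace_power_eq:
  assumes "1 \<le> k"
  defines "F \<equiv> \<lambda>w. transfer_fun A B C (\<i> * complex_of_real w)"
  shows "trace (matpow (F w ** ctranspose (F w)) k) = trace (cmat (\<beta> k) ** cascade_gram A B C k k w)"
proof -
  define E where "E = resolvent A (\<i> * complex_of_real w)"
  define E' where "E' = ctranspose E"
  define g where "g j = cmat (\<gamma> j)" for j
  define b where "b j = cmat (\<beta> j)" for j
  define R where "R j = g j ** (E' ** b (Suc j) ** E) ** g j" for j
  define T where "T j = cascade_gram A B C j j w" for j
  obtain i where k: "k = Suc i" using assms(1) by (cases k) auto
  have R_Suc: "R (Suc j) = E ** (g j ** b j ** g j) ** E'" if "1 \<le> j" for j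
  proof -
    obtain l where j: "j = Suc l" using \<open>1 \<le> j\<close> by (cases j) auto
    show ?thesis
      using resolvent_sandwich_swap[OF gamma_Suc_Suc, of w l]
      by (simp add: j R_def E_def E'_def g_def b_def beta_Suc_Suc_Suc cmat_mult[symmetric]
          del: beta.simps gamma.simps)
  qed
  have R_1: "R 1 = E ** cmat (\<gamma> 0 ** (transpose C ** C) ** \<gamma> 0) ** E'"
    using resolvent_sandwich_swap[OF gamma_1, of w]
    by (simp add: R_def E_def E'_def g_def b_def beta_2 cmat_mult[symmetric] del: beta.simps gamma.simps)
  have T_1: "T 1 = R 1"
    unfolding R_1 T_def cascade_gram_def E_def E'_def
    using gamma_sym[of 0]
    by (simp add: ctranspose_mult cmat_mult matrix_mul_assoc)
  have T_Suc: "T (Suc j) = (E ** (g j ** b j)) ** T j ** ((b j ** g j) ** E')" if "1 \<le> j" for j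
  proof -
    obtain l where j: "j = Suc l" using \<open>1 \<le> j\<close> by (cases j) auto
    have "cmat (\<alpha> (Suc j)) = g j ** b j" "ctranspose (b j) = b j" "ctranspose (g j) = g j"
      by (simp_all add: alpha_Suc g_def b_def cmat_mult matrix_transpose_mul gamma_sym beta_sym j
          del: beta.simps gamma.simps)
    then show ?thesis
      by (simp add: T_def cascade_gram_def E_def E'_def ctranspose_mult matrix_mul_assoc del: alpha.simps)
  qed
  have T_Suc_power: "T (Suc i) = matpow (R (Suc i) ** b (Suc i)) i ** R (Suc i)"
    by (rule cascade_power(1)[of R g E' b E T, OF R_def R_Suc T_1 T_Suc])
  have "trace (b k ** T k) = trace (matpow (R k ** b k) i ** (R k ** b k))"
    unfolding trace_mul_sym[of "b k"] by (simp only: k T_Suc_power matrix_mul_assoc)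
  also have "\<dots> = trace (matpow (R k ** b k) k)"
    by (simp only: k matpow_commute matpow.simps)
  also have "\<dots> = trace (matpow (R 1 ** b 1) k)"
    unfolding k
    by (rule cascade_power(2)[of R g E' b E T, OF R_def R_Suc T_1 T_Suc]) (use assms(1) k in simp_all)
  \<comment> \<open>Splitting between \<open>transpose C\<close> and \<open>C\<close> and exchanging
    the factors passes from \<open>n \<times> n\<close> to \<open>p \<times> p\<close> matrices
    under the trace.\<close>
  also have "R 1 ** b 1 = (E ** g 0 ** cmat (transpose C)) ** (cmat C ** g 0 ** E' ** b 1)"
    unfolding R_1 by (simp add: g_def cmat_mult matrix_mul_assoc)
  also have "trace (matpow \<dots> k) = trace (matpow ((cmat C ** g 0 ** E' ** b 1) ** (E ** g 0 ** cmat (transpose C))) k)"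
    by (rule trace_matpow_commute[OF assms(1)])
  also have "(cmat C ** g 0 ** E' ** b 1) ** (E ** g 0 ** cmat (transpose C))
      = cmat C ** (g 0 ** (E' ** b 1 ** E) ** g 0) ** cmat (transpose C)"
    by (simp only: matrix_mul_assoc)
  \<comment> \<open>The same swap for the controllability Gramian, read backwards, produces the
    middle part of \<open>F\<close> times its adjoint.\<close>
  also have "g 0 ** (E' ** b 1 ** E) ** g 0 = E ** cmat (B ** transpose B) ** E'"
  proof -
    have "\<gamma> 0 = lyap A (B ** transpose B)" by (simp add: ctr_gram_def)
    from resolvent_sandwich_swap[OF this, of w] show ?thesis
      by (simp add: g_def b_def E_def E'_def)
  qed
  also have "cmat C ** (E ** cmat (B ** transpose B) ** E') ** cmat (transpose C) = F w ** ctranspose (F w)"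
    by (simp add: F_def transfer_fun_def E_def E'_def ctranspose_mult cmat_mult matrix_mul_assoc)
  finally show ?thesis by (simp add: b_def T_def)
qed

end

section \<open>Frobenius norms and assembly of the identities\<close>

lemma frob_norm_square: "(frob_norm X)\<^sup>2 = Re (trace (ctranspose X ** X))"
proof -
  \<comment> \<open>The real \<open>sqrt\<close> preserves sign, so this yields nonnegativity of its
    argument, which squaring requires.\<close>
  have "0 \<le> sqrt (Re (frob_inner X X))"
    using frob_norm_eq_norm[of X] by (simp add: frob_norm_def)
  then show ?thesis by (simp add: frob_norm_def frob_inner_def)
qed

text \<open>Cyclicity brings the two outer factors together, so only the product
  \<open>R ** transpose R\<close> enters and both shapes of \<open>rho\<close> give the same
  expression.\<close>

lemma frob_norm_cascade:
  fixes R :: "real^'q^'n"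
  assumes "M = R ** transpose R"
  shows "(frob_norm (cmat (transpose R) ** cascade A B C k (\<i> * complex_of_real w) ** cmat (transpose C)))\<^sup>2
    = Re (trace (cmat M ** cascade_gram A B C k k w))"
proof -
  let ?H = "cascade A B C k (\<i> * complex_of_real w)"
  let ?Y = "?H ** cmat (transpose C) ** cmat C ** ctranspose ?H"
  have "trace (ctranspose (cmat (transpose R) ** ?H ** cmat (transpose C)) ** (cmat (transpose R) ** ?H ** cmat (transpose C)))
      = trace ((cmat (transpose R) ** ?H ** cmat (transpose C)) ** ctranspose (cmat (transpose R) ** ?H ** cmat (transpose C)))"
    by (rule trace_mul_sym)
  also have "\<dots> = trace (cmat (transpose R) ** (?Y ** cmat R))"
    by (simp add: ctranspose_mult matrix_mul_assoc)
  also have "\<dots> = trace ((?Y ** cmat R) ** cmat (transpose R))"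
    by (rule trace_mul_sym)
  also have "\<dots> = trace (?Y ** cmat M)"
    by (simp add: assms cmat_mult matrix_mul_assoc)
  also have "\<dots> = trace (cmat M ** ?Y)" by (rule trace_mul_sym)
  finally show ?thesis
    by (simp add: frob_norm_square cascade_gram_def cmat_mult matrix_mul_assoc)
qed

context controllable_recursion
begin

lemma h2_norm_sysG:
  assumes "1 \<le> k"
  shows "(case sysG A B C k of Inl G \<Rightarrow> h2_norm G | Inr G \<Rightarrow> h2_norm G)
    = sqrt (1 / (2 * pi) * (LINT w|lborel. Re (trace (cmat (\<beta> k) ** cascade_gram A B C k k w))))"
proof -
  have "gram_factor (\<beta> k) (rho A B C k)" using beta_factor[of "k - 1"] assms by simp
  then show ?thesis
    by (cases "rho A B C k") (simp_all add: sysG_def h2_norm_def frob_norm_cascade gram_factor_def)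
qed

lemma integral_trace_cascade_gram:
  assumes "1 \<le> k"
  shows "1 / (2 * pi) * (LINT w|lborel. Re (trace (cmat (\<beta> k) ** cascade_gram A B C k k w)))
    = frob_inner_real (\<beta> k) (Pmat A B C k k)"
proof -
  let ?T = "\<lambda>X. Re (trace (cmat (\<beta> k) ** X))"
  have T: "bounded_linear ?T"
    by (intro bounded_linear_compose[OF bounded_linear_Re] bounded_linear_compose[OF bounded_linear_trace]
        matrix_mult_complex.bounded_linear_right)
  have "(LINT w|lborel. ?T (cascade_gram A B C k k w)) = ?T ((2 * pi) *\<^sub>R cmat (Pmat A B C k k))"
    using integral_bounded_linear[OF T integrable_cascade_gram[OF hurwitz, of k k]] assms
    by (simp add: integral_cascade_gram[OF hurwitz])
  also have "\<dots> = (2 * pi) * ?T (cmat (Pmat A B C k k))"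
    using linear_cmul[OF bounded_linear.linear[OF T]] by simp
  also have "?T (cmat (Pmat A B C k k)) = frob_inner_real (\<beta> k) (Pmat A B C k k)"
  proof -
    \<comment> \<open>The Frobenius product transposes its first argument, whereas the trace formula
      contains \<open>\<beta> k\<close> itself.\<close>
    have "transpose (\<beta> k) = \<beta> k" using beta_sym[of "k - 1"] assms by simp
    moreover have "trace (cmat X) = complex_of_real (trace X)" for X :: "real^'n^'n"
      by (simp add: trace_def cmat_def)
    ultimately show ?thesis by (simp add: frob_inner_real_def cmat_mult[symmetric])
  qed
  finally show ?thesis by simp
qed

end

theorem theorem5:
  fixes A :: "real^'n^'n" and B :: "real^'m^'n" and C :: "real^'n^'p"
  assumes "hurwitz A"
    and "controllable A B"
    and "controllable A (ctr_gram A B ** transpose C)"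
    and "\<And>j. 1 \<le> j \<Longrightarrow>
      (case rho A B C j of
         Inl R \<Rightarrow> controllable A (gamma A B C j ** R)
       | Inr R \<Rightarrow> controllable A (gamma A B C j ** R))"
  shows "\<forall>k\<ge>1.
      hs_norm k (transfer_fun A B C) =
        root k (case sysG A B C k of Inl G \<Rightarrow> h2_norm G | Inr G \<Rightarrow> h2_norm G) \<and>
      root k (case sysG A B C k of Inl G \<Rightarrow> h2_norm G | Inr G \<Rightarrow> h2_norm G) =
        root (2 * k) (frob_inner_real (beta A B C k) (Pmat A B C k k))"
proof (intro allI impI)
  fix k :: nat assume k: "1 \<le> k"
  interpret controllable_recursion A B C by unfold_locales (fact assms)+
  \<comment> \<open>Valid for every real \<open>x\<close>; it reduces both equations to the same
    expression under the roots.\<close>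
  have root: "root (2 * k) x = root k (sqrt x)" for x
    by (simp add: sqrt_def real_root_mult_exp mult.commute[of 2])
  show "hs_norm k (transfer_fun A B C) =
        root k (case sysG A B C k of Inl G \<Rightarrow> h2_norm G | Inr G \<Rightarrow> h2_norm G) \<and>
      root k (case sysG A B C k of Inl G \<Rightarrow> h2_norm G | Inr G \<Rightarrow> h2_norm G) =
        root (2 * k) (frob_inner_real (beta A B C k) (Pmat A B C k k))"
    unfolding hs_norm_def trace_power_eq[OF k] h2_norm_sysG[OF k] root
      integral_trace_cascade_gram[OF k] by simp
qed

end
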